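(* Let $\{\lambda_n\}_{n\ge1}\subset\mathbb{D}$ be an interpolating sequence and let $\{w_n\}_{n\ge1} \subset \mathbb{C} \setminus \{0\}$ be such that the sequence $(1-|\lambda_n|)\log|w_n|$ does not converge to $0$ as $n\to\infty$. Then any $\phi \in N^{+}$ satisfying $\phi(\lambda_n) = w_n$ for all $n\ge1$ must have a non-trivial (i.e. nonconstant) inner factor.
   Context: $\mathbb{D}$ is the open unit disk in $\mathbb{C}$, $\mathbb{T}$ the unit circle, $m$ normalized Lebesgue measure on $\mathbb{T}$, $H^\infty$ the bounded analytic functions on $\mathbb{D}$. A sequence $\Lambda=\{\lambda_n\}_{n\ge1}$ of distinct points of $\mathbb{D}$ is interpolating if $\delta(\Lambda) := \inf_{n \geq 1} \prod_{k\ge 1, k \ne n} \left| \frac{\lambda_k-\lambda_n}{1-\overline{\lambda}_k \lambda_n}\right| > 0$. An outer function is an analytic function on $\mathbb{D}$ of the form $\phi(z)=\gamma\exp\big(\int_{\mathbb{T}} \frac{\xi + z}{\xi - z} W(\xi)\, dm(\xi)\big)$, where $|\gamma|=1$ and $W$ is an extended real-valued integrable function on $\mathbb{T}$. An inner function is an $I\in H^\infty$ whose radial boundary values are unimodular almost everywhere on $\mathbb{T}$. The Smirnov class is $N^{+} = \{f/g: f \in H^{\infty},\ g \in H^{\infty} \text{ outer}\}$. Every $F \in N^{+}$, $F\not\equiv 0$, factors as $F = I_{F} O_{F}$ with $I_F$ inner (the inner factor of $F$) and $O_F$ outer, uniquely up to unimodular constants. *)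

theory Defs
  imports "HOL-Complex_Analysis.Complex_Analysis"
begin

abbreviation unit_disk :: "complex set" where
  "unit_disk \<equiv> ball 0 1"

definition circle_measure :: "complex measure" where
  "circle_measure =
     distr (uniform_measure lborel {0..2*pi}) (restrict_space borel (sphere 0 1)) cis"

(* The partial products are decreasing in N and bounded below by 0, so the limit always exists.
   It is written with lim because prodinf has no useful value when the product diverges to 0. *)
definition separation_constant :: "(nat \<Rightarrow> complex) \<Rightarrow> real" where
  "separation_constant \<Lambda> =
     (INF n. lim (\<lambda>N. \<Prod>k\<in>{..<N} - {n}. norm ((\<Lambda> k - \<Lambda> n) / (1 - cnj (\<Lambda> k) * \<Lambda> n))))"

definition interpolating_sequence :: "(nat \<Rightarrow> complex) \<Rightarrow> bool" where
  "interpolating_sequence \<Lambda> \<longleftrightarrow>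
     inj \<Lambda> \<and> range \<Lambda> \<subseteq> unit_disk \<and> separation_constant \<Lambda> > 0"

definition bounded_analytic :: "(complex \<Rightarrow> complex) \<Rightarrow> bool" where
  "bounded_analytic f \<longleftrightarrow> f holomorphic_on unit_disk \<and> bounded (f ` unit_disk)"

(* An integrable W is finite almost everywhere, so the value 0 that real_of_ereal gives to
   infinite values does not affect the integral. *)
definition outer_function :: "(complex \<Rightarrow> complex) \<Rightarrow> bool" where
  "outer_function f \<longleftrightarrow> f holomorphic_on unit_disk \<and>
     (\<exists>(\<gamma>::complex) (W :: complex \<Rightarrow> ereal).
        norm \<gamma> = 1 \<and>
        W \<in> borel_measurable circle_measure \<and>
        (\<integral>\<^sup>+\<xi>. e2ennreal \<bar>W \<xi>\<bar> \<partial>circle_measure) < \<infinity> \<and>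
        (\<forall>z\<in>unit_disk. f z =
           \<gamma> * exp (LINT \<xi>|circle_measure.
                      (\<xi> + z) / (\<xi> - z) * complex_of_real (real_of_ereal (W \<xi>)))))"

definition inner_function :: "(complex \<Rightarrow> complex) \<Rightarrow> bool" where
  "inner_function f \<longleftrightarrow> bounded_analytic f \<and>
     (AE \<xi> in circle_measure.
        \<exists>l. ((\<lambda>r. f (complex_of_real r * \<xi>)) \<longlongrightarrow> l) (at_left 1) \<and> norm l = 1)"

definition smirnov_class :: "(complex \<Rightarrow> complex) set" where
  "smirnov_class = {F. \<exists>f g. bounded_analytic f \<and> bounded_analytic g \<and> outer_function g \<and>
                             (\<forall>z\<in>unit_disk. F z = f z / g z)}"

(* For F in the Smirnov class, not identically zero, such an I exists and is unique up to a
   unimodular constant. *)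
definition is_inner_factor :: "(complex \<Rightarrow> complex) \<Rightarrow> (complex \<Rightarrow> complex) \<Rightarrow> bool" where
  "is_inner_factor F I \<longleftrightarrow> inner_function I \<and>
     (\<exists>G. outer_function G \<and> (\<forall>z\<in>unit_disk. F z = I z * G z))"

end

theory Submission
  imports Defs
begin

text \<open>If an inner factor \<open>I\<close> of \<open>\<phi>\<close> is constant, then \<open>ln \<bar>\<phi>\<bar>\<close> is, up to a constant, the Poisson integral of an
  integrable function \<open>W\<close>, and \<open>(1 - \<bar>z\<bar>)\<close> times such an integral tends to \<open>0\<close> at the boundary, which the
  separated points \<open>\<Lambda> n\<close> approach. It remains to see that an inner factor exists. For \<open>\<bar>f\<bar> \<le> 1\<close> with boundary
  values \<open>F\<close>, subharmonicity of \<open>ln \<bar>f\<bar>\<close> makes \<open>W = ln \<bar>F\<bar>\<close> integrable and bounds \<open>\<bar>f\<bar>\<close> by the modulus of the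
  outer function \<open>G\<close> of \<open>W\<close>. The truncations \<open>V n = max W (-n)\<close> yield bounded outer functions \<open>H n\<close> with
  \<open>\<bar>f\<bar> \<le> \<bar>G\<bar> \<le> \<bar>H n\<bar>\<close>; on the circle \<open>ln \<bar>H n\<bar>\<close> dominates \<open>V n\<close> and has the same integral, so the two agree
  almost everywhere. Hence \<open>\<bar>G\<bar> = \<bar>F\<bar>\<close> on the circle and \<open>f / G\<close> is inner.

  Boundary values exist by the maximal function argument: radial maximal functions are controlled by
  centered averages, which satisfy a weak type estimate by Vitali's covering lemma, and polynomials
  are dense in the Hardy space \<open>H\<^sup>1\<close> norm.\<close>

subsection \<open>Normalized Lebesgue measure on the circle and the Poisson formula\<close>

text \<open>Nearly all of the work is caused by the definition of an inner function, which asks for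
  unimodular radial limits almost everywhere. For this the boundary modulus of \<open>G\<close> must
  be known, and that is the obstacle: radial limits are proved for bounded analytic functions, not
  for Poisson integrals of arbitrary integrable functions, so \<open>|G| = exp W\<close> on the
  circle cannot be read off from the representation of \<open>G\<close>. The inequality
  \<open>|f| <= |G|\<close> gives one half. For the other half the truncation at \<open>- n\<close>
  makes the comparison of integrals possible: \<open>V n\<close> is bounded, so the logarithm of
  \<open>|H n|\<close> stays bounded in the disk and its circle means pass to the boundary by
  dominated convergence, which does not apply directly to an unbounded \<open>W\<close>. A positive
  floor serves a second time: \<open>max |f| e\<close> has a continuous logarithm on the closed disk
  when \<open>f\<close> is continuous there, so the subharmonic estimate reduces to the maximum
  principle for one analytic function.\<close>

lemma cis_measurable_circle:
  "cis \<in> measurable (uniform_measure lborel {0..2*pi}) (restrict_space borel (sphere 0 1))"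
proof -
  have "continuous_on UNIV cis" by (intro continuous_intros)
  then have "cis \<in> borel_measurable borel" by (rule borel_measurable_continuous_onI)
  then have "cis \<in> measurable (uniform_measure lborel {0..2*pi}) borel"
    by simp
  then show ?thesis
    by (rule measurable_restrict_space2[rotated]) auto
qed

lemma space_circle_measure [simp]: "space circle_measure = sphere 0 1"
  by (simp add: circle_measure_def space_restrict_space)

lemma sets_circle_measure [simp, measurable_cong]:
  "sets circle_measure = sets (restrict_space borel (sphere 0 1))"
  by (simp add: circle_measure_def)

lemma emeasure_circle_measure:
  assumes "A \<in> sets circle_measure"
  shows "emeasure circle_measure A = emeasure lborel ({0..2*pi} \<inter> cis -` A) / ennreal (2*pi)"
proof -
  have "cis -` A \<in> sets borel"
    using measurable_sets[OF cis_measurable_circle, of A] assms by simp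
  then show ?thesis
    using assms unfolding circle_measure_def
    by (subst emeasure_distr[OF cis_measurable_circle]) simp_all
qed

lemma finite_measure_circle: "finite_measure circle_measure"
  and measure_circle_space: "measure circle_measure (sphere 0 1) = 1"
proof -
  have *: "emeasure circle_measure (sphere 0 1) = 1"
  proof -
    have "sphere 0 1 \<in> sets circle_measure"
      by (metis space_circle_measure sets.top)
    moreover have "{0..2*pi} \<inter> cis -` sphere 0 1 = {0..2*pi}" by auto
    ultimately show ?thesis
      by (simp add: emeasure_circle_measure divide_ennreal)
  qed
  then show "finite_measure circle_measure"
    by (intro finite_measureI) simp
  show "measure circle_measure (sphere 0 1) = 1"
    using * by (simp add: measure_def)
qed

interpretation circle: finite_measure circle_measure
  by (rule finite_measure_circle)

lemma borel_measurable_circle_continuous: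
  "continuous_on (sphere 0 1) g \<Longrightarrow> g \<in> borel_measurable circle_measure"
  using borel_measurable_continuous_on_restrict[of "sphere 0 1" g]
  by (simp cong: measurable_cong_sets)

lemma integrable_circle_continuous:
  fixes g :: "complex \<Rightarrow> 'b::{banach, second_countable_topology}"
  assumes "continuous_on (sphere 0 1) g"
  shows "integrable circle_measure g"
proof -
  have "compact (g ` sphere 0 1)"
    by (rule compact_continuous_image[OF assms]) simp
  then obtain B where "\<And>\<xi>. \<xi> \<in> sphere 0 1 \<Longrightarrow> norm (g \<xi>) \<le> B"
    using compact_imp_bounded[of "g ` sphere 0 1"] unfolding bounded_iff by blast
  then show ?thesis
    by (intro circle.integrable_const_bound[of _ B] borel_measurable_circle_continuous assms AE_I2) auto
qed

text \<open>Bridge between two settings: contour integrals and the covering argument on the line use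
  gauge integrals over angles, while limits and almost everywhere statements use
  \<open>circle_measure\<close>.\<close>

lemma has_integral_circle:
  fixes g :: "complex \<Rightarrow> 'b::euclidean_space"
  assumes g: "continuous_on (sphere 0 1) g"
  shows "((\<lambda>t. g (cis t)) has_integral (2*pi) *\<^sub>R (LINT \<xi>|circle_measure. g \<xi>)) {0..2*pi}"
proof -
  have c: "continuous_on {0..2*pi} (\<lambda>t. g (cis t))"
    by (rule continuous_on_compose2[OF g]) (auto intro!: continuous_intros)
  then have si: "set_integrable lborel {0..2*pi} (\<lambda>t. g (cis t))"
    by (rule borel_integrable_atLeastAtMost')
  have cis: "cis \<in> measurable borel (restrict_space borel (sphere 0 1))"
    using cis_measurable_circle by simp
  have gm: "(\<lambda>t. g (cis t)) \<in> borel_measurable borel"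
    using measurable_compose[OF cis, of g] borel_measurable_circle_continuous[OF g]
    by (simp cong: measurable_cong_sets)
  have "(LINT \<xi>|circle_measure. g \<xi>) = (LINT t|uniform_measure lborel {0..2*pi}. g (cis t))"
    unfolding circle_measure_def
    by (rule integral_distr[OF cis_measurable_circle])
       (use borel_measurable_circle_continuous[OF g] in \<open>simp cong: measurable_cong_sets\<close>)
  also have "uniform_measure lborel {0..2*pi} = density lborel (\<lambda>t. ennreal (indicator {0..2*pi} t / (2*pi)))"
    unfolding uniform_measure_def
    by (intro density_cong) (auto simp: divide_ennreal simp flip: ennreal_indicator)
  also have "(LINT t|density lborel (\<lambda>t. ennreal (indicator {0..2*pi} t / (2*pi))). g (cis t))
     = (LINT t|lborel. (indicator {0..2*pi} t / (2*pi)) *\<^sub>R g (cis t))"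
    by (rule integral_density) (use gm in auto)
  also have "\<dots> = (LINT t|lborel. (1 / (2*pi)) *\<^sub>R (indicator {0..2*pi} t *\<^sub>R g (cis t)))"
    by (intro Bochner_Integration.integral_cong) auto
  also have "\<dots> = (1 / (2*pi)) *\<^sub>R (LINT t:{0..2*pi}|lborel. g (cis t))"
    unfolding set_lebesgue_integral_def by (rule integral_scaleR_right)
  also have "(LINT t:{0..2*pi}|lborel. g (cis t)) = integral {0..2*pi} (\<lambda>t. g (cis t))"
    by (rule set_borel_integral_eq_integral[OF si])
  finally show ?thesis
    using integrable_integral[OF set_borel_integral_eq_integral(1)[OF si]] by simp
qed

text \<open>On the unit circle \<open>d\<xi> = \<i> * \<xi> * dt\<close>, so dividing the contour
  integral by \<open>2 * pi * \<i>\<close> turns it into an average over angles and leaves the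
  factor \<open>\<xi>\<close> in the numerator.\<close>

lemma Cauchy_integral_circle:
  assumes "continuous_on (cball 0 1) f" "f holomorphic_on ball 0 1" "norm z < 1"
  shows "(LINT \<xi>|circle_measure. f \<xi> * \<xi> / (\<xi> - z)) = f z"
proof -
  have "continuous_on (sphere 0 1) f"
    by (rule continuous_on_subset[OF assms(1)]) auto
  then have c: "continuous_on (sphere 0 1) (\<lambda>\<xi>. f \<xi> * \<xi> / (\<xi> - z))"
    using assms(3) by (intro continuous_intros) auto
  have "((\<lambda>u. f u / (u-z)) has_contour_integral (2 * of_real pi * \<i> * f z)) (part_circlepath 0 1 0 (2*pi))"
    using Cauchy_integral_circlepath[of 0 1 f z] assms unfolding circlepath_def by simp
  then have "((\<lambda>t. f (cis t) / (cis t - z) * \<i> * cis t) has_integral (2 * of_real pi * \<i> * f z)) {0..2*pi}"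
    by (subst (asm) has_contour_integral_part_circlepath_iff) auto
  then have "((\<lambda>t. - \<i> * (f (cis t) / (cis t - z) * \<i> * cis t)) has_integral - \<i> * (2 * of_real pi * \<i> * f z)) {0..2*pi}"
    by (rule has_integral_mult_right)
  moreover have "- \<i> * (x * \<i> * y) = x * y" for x y
    by (simp add: complex_eq_iff)
  then have "(\<lambda>t. - \<i> * (f (cis t) / (cis t - z) * \<i> * cis t)) = (\<lambda>t. f (cis t) * cis t / (cis t - z))"
    by (simp del: mult_minus_left)
  ultimately have "((\<lambda>t. f (cis t) * cis t / (cis t - z)) has_integral 2 * of_real pi * f z) {0..2*pi}"
    by (simp add: algebra_simps)
  from has_integral_unique[OF this has_integral_circle[OF c]]
  show ?thesis by (simp add: scaleR_conv_of_real)
qed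

definition Poisson :: "complex \<Rightarrow> complex \<Rightarrow> real" where
  "Poisson z \<xi> = (1 - (norm z)\<^sup>2) / (norm (\<xi> - z))\<^sup>2"

lemma Poisson_nonneg: "norm z < 1 \<Longrightarrow> 0 \<le> Poisson z \<xi>"
  unfolding Poisson_def by (simp add: power_le_one)

lemma continuous_on_Poisson: "norm z < 1 \<Longrightarrow> continuous_on (sphere 0 1) (Poisson z)"
  unfolding Poisson_def by (intro continuous_intros) auto

text \<open>This growth rate is exactly what the weight \<open>1 - norm z\<close> in the final limit
  cancels.\<close>

lemma Poisson_le: "norm z < 1 \<Longrightarrow> norm \<xi> = 1 \<Longrightarrow> Poisson z \<xi> \<le> 2 / (1 - norm z)"
proof -
  assume z: "norm z < 1" "norm \<xi> = 1"
  have "1 - norm z \<le> norm (\<xi> - z)" using norm_triangle_ineq2[of \<xi> z] z by simp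
  then have "(1 - norm z)\<^sup>2 \<le> (norm (\<xi> - z))\<^sup>2" using z by (intro power_mono) auto
  then have "Poisson z \<xi> \<le> (1 - (norm z)\<^sup>2) / (1 - norm z)\<^sup>2"
    unfolding Poisson_def using z
    by (intro divide_left_mono mult_pos_pos) (auto simp: power_le_one zero_less_power2)
  also have "1 - (norm z)\<^sup>2 = (1 - norm z) * (1 + norm z)" by (simp add: power2_eq_square algebra_simps)
  also have "\<dots> / (1 - norm z)\<^sup>2 = (1 + norm z) / (1 - norm z)" using z by (simp add: power2_eq_square)
  also have "\<dots> \<le> 2 / (1 - norm z)" using z by (intro divide_right_mono) auto
  finally show ?thesis .
qed

text \<open>The denominator is at most \<open>4\<close> and \<open>1 - (norm z)\<^sup>2\<close> is
  at least \<open>1 - norm z\<close>. At a fixed point this converts a bound on a Poisson integral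
  of a function of constant sign into a bound on its plain integral.\<close>

lemma Poisson_ge:
  assumes z: "norm z < 1" "norm \<xi> = 1"
  shows "(1 - norm z) / 4 \<le> Poisson z \<xi>"
proof -
  have "norm (\<xi> - z) \<le> 2" using norm_triangle_ineq4[of \<xi> z] z by simp
  then have "(norm (\<xi> - z))\<^sup>2 \<le> 2\<^sup>2" by (intro power_mono) auto
  then have "(1 - (norm z)\<^sup>2) / 2\<^sup>2 \<le> Poisson z \<xi>"
    unfolding Poisson_def using z by (intro divide_left_mono) (auto simp: power_le_one)
  moreover have "(norm z)\<^sup>2 \<le> norm z" using z by (simp add: power2_eq_square mult_left_le)
  ultimately show ?thesis by simp
qed

lemma Re_Herglotz_kernel: "norm \<xi> = 1 \<Longrightarrow> Re ((\<xi> + z) / (\<xi> - z)) = Poisson z \<xi>"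
proof -
  assume "norm \<xi> = 1"
  then have "(Re \<xi>)\<^sup>2 + (Im \<xi>)\<^sup>2 = 1" by (metis cmod_power2 one_power2)
  then show ?thesis
    unfolding Poisson_def
    by (simp add: Re_divide cmod_power2) (simp add: power2_eq_square algebra_simps)
qed

text \<open>Applying Cauchy's formula at \<open>z\<close> to \<open>f\<close> times the kernel
  \<open>(1 - \<bar>z\<bar>\<^sup>2) / (1 - cnj z * \<xi>)\<close>, which is \<open>1\<close> at \<open>z\<close>, gives Poisson's formula.\<close>

lemma Poisson_integral:
  assumes "continuous_on (cball 0 1) f" "f holomorphic_on ball 0 1" "norm z < 1"
  shows "(LINT \<xi>|circle_measure. complex_of_real (Poisson z \<xi>) * f \<xi>) = f z"
proof -
  define g where "g \<xi> = f \<xi> * (1 - (norm z)\<^sup>2) / (1 - cnj z * \<xi>)" for \<xi>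
  have nz: "1 - cnj z * \<xi> \<noteq> 0" if "norm \<xi> \<le> 1" for \<xi>
  proof
    assume "1 - cnj z * \<xi> = 0"
    then have "norm (cnj z * \<xi>) = 1" by (metis eq_iff_diff_eq_0 norm_one)
    then have "norm z * norm \<xi> = 1" by (simp add: norm_mult)
    moreover have "norm z * norm \<xi> < 1"
      using assms(3) that by (metis mult_left_le norm_ge_zero order_le_less_trans)
    ultimately show False by simp
  qed
  have "(LINT \<xi>|circle_measure. g \<xi> * \<xi> / (\<xi> - z)) = g z"
    by (rule Cauchy_integral_circle)
       (use assms nz in \<open>auto simp: g_def intro!: continuous_intros holomorphic_intros\<close>)
  moreover have "g z = f z"
  proof -
    have "1 - cnj z * z = complex_of_real (1 - (norm z)\<^sup>2)"
      by (metis complex_norm_square mult.commute of_real_1 of_real_diff)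
    moreover have "1 - cnj z * z \<noteq> 0" using nz[of z] assms(3) by simp
    ultimately show ?thesis by (simp add: g_def)
  qed
  moreover have "g \<xi> * \<xi> / (\<xi> - z) = complex_of_real (Poisson z \<xi>) * f \<xi>" if "\<xi> \<in> space circle_measure" for \<xi>
  proof -
    have n: "norm \<xi> = 1" using that by simp
    then have x: "\<xi> * cnj \<xi> = 1" by (simp add: complex_norm_square[symmetric])
    have "(1 - cnj z * \<xi>) = \<xi> * cnj (\<xi> - z)" using x by (simp add: algebra_simps)
    then have "g \<xi> * \<xi> / (\<xi> - z) = f \<xi> * (1 - (norm z)\<^sup>2) * \<xi> / (\<xi> * (cnj (\<xi> - z) * (\<xi> - z)))"
      by (simp add: g_def mult.assoc)
    also have "\<dots> = f \<xi> * (1 - (norm z)\<^sup>2) / ((\<xi> - z) * cnj (\<xi> - z))"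
      using n by (auto simp: mult_ac)
    also have "(\<xi> - z) * cnj (\<xi> - z) = complex_of_real ((norm (\<xi> - z))\<^sup>2)"
      by (metis complex_norm_square)
    finally show ?thesis by (simp add: Poisson_def)
  qed
  ultimately show ?thesis
    by (metis (no_types, lifting) Bochner_Integration.integral_cong)
qed

lemma integral_Poisson: "norm z < 1 \<Longrightarrow> (LINT \<xi>|circle_measure. Poisson z \<xi>) = 1"
proof -
  assume z: "norm z < 1"
  have "complex_of_real (LINT \<xi>|circle_measure. Poisson z \<xi>) = 1"
    using Poisson_integral[of "\<lambda>_. 1" z] z by simp
  then show ?thesis by (metis of_real_eq_1_iff)
qed

lemma integral_Herglotz_kernel:
  "norm z < 1 \<Longrightarrow> (LINT \<xi>|circle_measure. (\<xi> + z) / (\<xi> - z)) = 1"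
proof -
  assume z: "norm z < 1"
  have c: "continuous_on (sphere 0 1) (\<lambda>\<xi>. \<xi> / (\<xi> - z))"
    using z by (intro continuous_intros) auto
  have "(LINT \<xi>|circle_measure. (\<xi> + z) / (\<xi> - z)) = (LINT \<xi>|circle_measure. 2 * (\<xi> / (\<xi> - z)) - 1)"
    using z by (intro Bochner_Integration.integral_cong) (auto simp: divide_simps)
  also have "\<dots> = 2 * (LINT \<xi>|circle_measure. \<xi> / (\<xi> - z)) - 1"
    using integrable_circle_continuous[OF c]
    by (subst Bochner_Integration.integral_diff)
       (auto simp: measure_circle_space simp del: times_divide_eq_right)
  also have "\<dots> = 1"
    using Cauchy_integral_circle[of "\<lambda>_. 1" z] z by simp
  finally show ?thesis .
qed

subsection \<open>Centered averages\<close>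

text \<open>A symmetric kernel that decreases away from \<open>0\<close> is a positive mixture of
  centered averages, so it inherits their common bound. Integration by parts takes the place of the
  mixture; the boundary term at \<open>a\<close> has the right sign because
  \<open>0 \<le> p a\<close>.\<close>

lemma integral_symmetric_decreasing_kernel_le:
  fixes u p p' :: "real \<Rightarrow> real"
  assumes a: "0 \<le> a"
    and u: "continuous_on {-a..a} u"
    and p: "\<And>s. (p has_real_derivative p' s) (at s)"
    and p': "\<And>s. s \<in> {0..a} \<Longrightarrow> p' s \<le> 0"
    and even: "\<And>s. p (-s) = p s" and pa: "0 \<le> p a"
    and avg: "\<And>s. 0 < s \<Longrightarrow> s \<le> a \<Longrightarrow> integral {-s..s} u \<le> 2 * s * c"
  shows "integral {-a..a} (\<lambda>s. p s * u s) \<le> c * integral {-a..a} p"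
proof -
  define U where "U s = integral {-a..s} u" for s
  define H where "H s = U s - U (-s)" for s
  have H: "H s = integral {-s..s} u" if "s \<in> {0..a}" for s
    using Henstock_Kurzweil_Integration.integral_combine[of "-a" "-s" s u] that
      integrable_continuous_real[OF continuous_on_subset[OF u, of "{-a..s}"]]
    unfolding H_def U_def by simp
  have Hle: "H s \<le> 2 * s * c" if "s \<in> {0..a}" for s
    using that H[OF that] avg[of s] by (cases "s = 0") (auto simp: H_def)
  have dU: "(U has_real_derivative u s) (at s within {-a..a})" if "s \<in> {-a..a}" for s
    unfolding U_def by (rule integral_has_real_derivative[OF u that])
  have dU1: "(U has_real_derivative u s) (at s within {0..a})" if "s \<in> {0..a}" for s
    by (rule DERIV_subset[OF dU]) (use that in auto)
  have dU2: "((\<lambda>s. U (-s)) has_real_derivative - u (-s)) (at s within {0..a})" if "s \<in> {0..a}" for s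
  proof -
    have "(U has_real_derivative u (-s)) (at (-s) within uminus ` {0..a})"
      by (rule DERIV_subset[OF dU]) (use that a in auto)
    from DERIV_image_chain[OF this, where Db="-1"]
    show ?thesis by (simp add: o_def DERIV_minus[OF DERIV_ident])
  qed
  \<comment> \<open>The kernel times the deficit of the average over \<open>{-s..s}\<close> below
    the bound. \<open>K 0 = 0\<close> and \<open>0 \<le> K a\<close>, so the integral of
    \<open>K'\<close> is nonnegative; its term with \<open>p'\<close> is nonpositive, and dropping
    it leaves the claim for the folded integral over \<open>{0..a}\<close>.\<close>
  define K where "K s = p s * (2 * s * c - H s)" for s
  define K' where "K' s = p' s * (2 * s * c - H s) + p s * (2 * c - (u s + u (-s)))" for s
  have dK: "(K has_real_derivative K' s) (at s within {0..a})" if "s \<in> {0..a}" for s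
    unfolding K_def K'_def H_def
    by (rule derivative_eq_intros dU1 dU2 that DERIV_subset[OF p] subset_UNIV refl)+
       (simp add: algebra_simps)
  have iK: "(K' has_integral K a - K 0) {0..a}"
    by (rule fundamental_theorem_of_calculus[OF a])
       (use dK in \<open>auto simp: has_real_derivative_iff_has_vector_derivative\<close>)
  have pc: "continuous_on A p" for A
    using p by (meson DERIV_continuous_on DERIV_subset subset_UNIV)
  have ic: "(f has_integral integral {0..a} f) {0..a}" if "continuous_on {0..a} f" for f :: "real \<Rightarrow> real"
    using that by (simp add: integrable_continuous_real integrable_integral)
  have u1: "continuous_on {0..a} u" and u2: "continuous_on {0..a} (\<lambda>s. u (-s))"
    using a by (auto intro: continuous_on_subset[OF u] intro!: continuous_on_compose2[OF u] continuous_intros)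
  have c1: "continuous_on {0..a} (\<lambda>s. p s * u s)" and c2: "continuous_on {0..a} (\<lambda>s. p s * u (-s))"
    by (intro continuous_intros pc u1 u2)+
  have I: "((\<lambda>s. p s * (2 * c - (u s + u (-s)))) has_integral
       2 * c * integral {0..a} p - (integral {0..a} (\<lambda>s. p s * u s) + integral {0..a} (\<lambda>s. p s * u (-s)))) {0..a}"
  proof -
    have "((\<lambda>s. 2 * c * p s - (p s * u s + p s * u (-s))) has_integral
       2 * c * integral {0..a} p - (integral {0..a} (\<lambda>s. p s * u s) + integral {0..a} (\<lambda>s. p s * u (-s)))) {0..a}"
      by (intro has_integral_diff has_integral_add has_integral_mult_right ic pc c1 c2)
    then show ?thesis by (simp add: algebra_simps)
  qed
  have le: "K' s \<le> p s * (2 * c - (u s + u (-s)))" if "s \<in> {0..a}" for s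
  proof -
    have "p' s * (2 * s * c - H s) \<le> 0"
      using p'[OF that] Hle[OF that] by (simp add: mult_nonpos_nonneg)
    then show ?thesis by (simp add: K'_def)
  qed
  have "0 \<le> K a - K 0"
    using Hle[of a] a pa by (simp add: K_def H_def)
  also have "\<dots> \<le> 2 * c * integral {0..a} p - (integral {0..a} (\<lambda>s. p s * u s) + integral {0..a} (\<lambda>s. p s * u (-s)))"
    by (rule has_integral_le[OF iK I le])
  finally have main: "integral {0..a} (\<lambda>s. p s * u s) + integral {0..a} (\<lambda>s. p s * u (-s)) \<le> 2 * c * integral {0..a} p"
    by simp
  have split: "integral {-a..a} f = integral {0..a} (\<lambda>s. f (-s)) + integral {0..a} f"
    if "continuous_on {-a..a} f" for f :: "real \<Rightarrow> real"
    using Henstock_Kurzweil_Integration.integral_combine[of "-a" 0 a f] integrable_continuous_real[OF that] a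
      Henstock_Kurzweil_Integration.integral_reflect_real[where a=0 and b=a and f="\<lambda>x. f (-x)"] by simp
  have "integral {-a..a} (\<lambda>s. p s * u s) = integral {0..a} (\<lambda>s. p s * u (-s)) + integral {0..a} (\<lambda>s. p s * u s)"
    by (subst split) (auto simp: even intro!: continuous_intros pc u)
  moreover have "integral {-a..a} p = 2 * integral {0..a} p"
    by (subst split) (auto simp: even pc)
  ultimately show ?thesis using main by (simp add: mult_ac)
qed

text \<open>As a function of the angle to the center, the Poisson kernel is even and decreasing on
  \<open>{0..pi}\<close>. The use is contrapositive: a value above \<open>c\<close> on a radius
  forces an average above \<open>c\<close> on some arc centered at the end of that radius.\<close>

lemma Poisson_circle_average_le:
  fixes G :: "complex \<Rightarrow> complex"
  assumes G: "continuous_on (cball 0 1) G" "G holomorphic_on ball 0 1"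
    and r: "0 \<le> r" "r < 1"
    and avg: "\<And>s. 0 < s \<Longrightarrow> s \<le> pi \<Longrightarrow> integral {\<theta>-s..\<theta>+s} (\<lambda>t. norm (G (cis t))) \<le> 2 * s * c"
  shows "norm (G (complex_of_real r * cis \<theta>)) \<le> c"
proof -
  define q where "q s = (1 - r\<^sup>2) / (1 - 2 * r * cos s + r\<^sup>2)" for s
  define q' where "q' s = - ((1 - r\<^sup>2) * (2 * r * sin s)) / (1 - 2 * r * cos s + r\<^sup>2)\<^sup>2" for s
  have den: "1 - 2 * r * cos s + r\<^sup>2 > 0" for s
  proof -
    have "0 < (1 - r)\<^sup>2" using r by simp
    also have "\<dots> = 1 - 2 * r * 1 + r\<^sup>2" by (simp add: power2_eq_square algebra_simps)
    also have "\<dots> \<le> 1 - 2 * r * cos s + r\<^sup>2" using r mult_left_mono[OF cos_le_one[of s], of "2*r"] by simp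
    finally show ?thesis .
  qed
  have q_even: "q (- s) = q s" for s by (simp add: q_def)
  have r2: "r\<^sup>2 \<le> 1" using r by (simp add: power_le_one)
  have dq: "(q has_real_derivative q' s) (at s)" for s
    unfolding q_def q'_def
    by (rule derivative_eq_intros refl | use den[of s] in \<open>simp add: power2_eq_square\<close>)+
  \<comment> \<open>Circle integrals run over \<open>{0..2*pi}\<close>, but the kernel estimate
    wants an interval symmetric about the peak. Moving the peak to angle \<open>pi\<close>, that is
    evaluating at \<open>- r\<close> and composing \<open>G\<close> with multiplication by
    \<open>- cis \<theta>\<close>, makes the substitution \<open>t - pi\<close> produce
    \<open>{-pi..pi}\<close>.\<close>
  have P: "Poisson (- of_real r) (cis t) = q (t - pi)" for t
  proof -
    have "(norm (cis t - (- of_real r)))\<^sup>2 = (cos t + r)\<^sup>2 + (sin t)\<^sup>2"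
      by (simp add: cmod_power2)
    also have "\<dots> = ((cos t)\<^sup>2 + (sin t)\<^sup>2) + 2 * r * cos t + r\<^sup>2" by (simp add: power2_eq_square algebra_simps)
    also have "\<dots> = 1 - 2 * r * cos (t - pi) + r\<^sup>2" by (simp add: cos_diff)
    finally show ?thesis using r by (simp add: Poisson_def q_def)
  qed
  define h where "h s = norm (G (cis (\<theta> + s)))" for s
  have contG: "continuous_on A (\<lambda>s. norm (G (cis (g s))))" if "continuous_on A g" for A :: "real set" and g
    using that by (intro continuous_intros continuous_on_compose2[OF G(1)]) auto
  have ch: "continuous_on A h" for A unfolding h_def by (intro contG continuous_intros)
  have shift: "integral {0..2*pi} (\<lambda>t. f (t - pi)) = integral {-pi..pi} f" for f :: "real \<Rightarrow> real"
    using integral_shift_real_ivl[of "-pi" "-pi" pi f] by simp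
  have nr: "norm (- complex_of_real r) < 1" using r by simp
  have cP: "continuous_on (sphere 0 1) (Poisson (- of_real r))" by (rule continuous_on_Poisson[OF nr])
  have cGm: "continuous_on (cball 0 1) (\<lambda>\<xi>. G (- cis \<theta> * \<xi>))"
    by (rule continuous_on_compose2[OF G(1)]) (auto intro!: continuous_intros simp: norm_mult)
  have i1: "integral {-pi..pi} q = 2 * pi"
    using has_integral_circle[OF cP] integral_Poisson[OF nr] shift[of q]
    by (simp add: P integral_unique)
  have c3: "continuous_on (sphere 0 1) (\<lambda>\<xi>. Poisson (- of_real r) \<xi> * norm (G (- cis \<theta> * \<xi>)))"
    by (intro continuous_intros cP continuous_on_subset[OF cGm]) auto
  have e: "- cis \<theta> * cis t = cis (\<theta> + (t - pi))" for t
  proof -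
    have "cis (\<theta> + (t - pi)) = cis \<theta> * cis t * cis (-pi)" by (simp add: cis_mult add_diff_eq)
    then show ?thesis by (simp add: add_diff_eq cis_conv_exp[of "-pi"] exp_minus)
  qed
  have i2: "integral {-pi..pi} (\<lambda>s. q s * h s) = (2*pi) * (LINT \<xi>|circle_measure. Poisson (- of_real r) \<xi> * norm (G (- cis \<theta> * \<xi>)))"
    using has_integral_circle[OF c3] shift[of "\<lambda>s. q s * h s"]
    by (simp only: P e h_def integral_unique real_scaleR_def)
  have "norm (G (complex_of_real r * cis \<theta>)) = norm (LINT \<xi>|circle_measure. complex_of_real (Poisson (- of_real r) \<xi>) * G (- cis \<theta> * \<xi>))"
  proof (subst Poisson_integral)
    show "(\<lambda>\<xi>. G (- cis \<theta> * \<xi>)) holomorphic_on ball 0 1"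
      by (rule holomorphic_on_compose_gen[OF _ G(2), unfolded o_def]) (auto intro!: holomorphic_intros simp: norm_mult)
  qed (use cGm nr in \<open>auto simp: mult_ac\<close>)
  also have "\<dots> \<le> (LINT \<xi>|circle_measure. norm (complex_of_real (Poisson (- of_real r) \<xi>) * G (- cis \<theta> * \<xi>)))"
    by (rule integral_norm_bound)
  also have "\<dots> = (LINT \<xi>|circle_measure. Poisson (- of_real r) \<xi> * norm (G (- cis \<theta> * \<xi>)))"
    by (simp add: norm_mult Poisson_nonneg[OF nr])
  also have "\<dots> = integral {-pi..pi} (\<lambda>s. q s * h s) / (2*pi)"
    by (simp add: i2)
  also have "\<dots> \<le> (c * integral {-pi..pi} q) / (2*pi)"
  proof (rule divide_right_mono)
    show "integral {-pi..pi} (\<lambda>s. q s * h s) \<le> c * integral {-pi..pi} q"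
    proof (rule integral_symmetric_decreasing_kernel_le[where p' = q'])
      show "q' s \<le> 0" if "s \<in> {0..pi}" for s
      proof -
        have "0 \<le> sin s" using that by (intro sin_ge_zero) auto
        then have "0 \<le> (1 - r\<^sup>2) * (2 * r * sin s)" using r r2 by simp
        then show ?thesis unfolding q'_def by (intro divide_nonpos_nonneg) auto
      qed
      show "0 \<le> q pi" using den[of pi] r2 unfolding q_def by (intro divide_nonneg_pos) auto
      show "integral {-s..s} h \<le> 2 * s * c" if "0 < s" "s \<le> pi" for s
      proof -
        have "integral {-s..s} h = integral {\<theta>-s..\<theta>+s} (\<lambda>t. norm (G (cis t)))"
          using integral_shift_real_ivl[of "\<theta>-s" \<theta> "\<theta>+s" "\<lambda>t. norm (G (cis t))"]
          by (simp add: h_def[abs_def] add.commute)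
        then show ?thesis using avg[OF that] by simp
      qed
    qed (use dq ch q_even in auto)
  qed auto
  also have "\<dots> = c" by (simp add: i1)
  finally show ?thesis .
qed

text \<open>Vitali's lemma selects disjoint intervals whose fivefold enlargements cover
  \<open>E\<close>. An enlargement has length \<open>10 * s \<theta>\<close>, at most
  \<open>5 / c\<close> times the integral of \<open>h\<close> over the original interval, and
  disjointness sums these integrals to at most the total. \<open>E\<close> is an arbitrary set,
  hence the Borel superset \<open>A\<close>.\<close>

lemma weak_type_centered_averages:
  fixes h :: "real \<Rightarrow> real" and s :: "real \<Rightarrow> real"
  assumes h: "continuous_on UNIV h" "\<And>t. 0 \<le> h t"
    and c: "0 < c"
    and s: "\<And>\<theta>. \<theta> \<in> E \<Longrightarrow> 0 < s \<theta> \<and> s \<theta> \<le> B"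
    and big: "\<And>\<theta>. \<theta> \<in> E \<Longrightarrow> 2 * s \<theta> * c \<le> integral {\<theta> - s \<theta>..\<theta> + s \<theta>} h"
    and sub: "\<And>\<theta>. \<theta> \<in> E \<Longrightarrow> {\<theta> - s \<theta>..\<theta> + s \<theta>} \<subseteq> {a..b}"
  obtains A where "A \<in> sets borel" "E \<subseteq> A" "emeasure lborel A \<le> ennreal (5 / c * integral {a..b} h)"
proof -
  have cb: "cball \<theta> t = {\<theta> - t..\<theta> + t}" for \<theta> t :: real by (rule cball_eq_atLeastAtMost)
  have E: "E \<subseteq> (\<Union>i\<in>E. cball i (s i))" using s by force
  obtain C where C: "countable C" "C \<subseteq> E"
     "pairwise (\<lambda>i j. disjnt (cball i (s i)) (cball j (s j))) C"
     "E \<subseteq> (\<Union>i\<in>C. cball i (5 * s i))"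
    by (rule Vitali_covering_lemma_cballs[OF E, of B]) (use s in auto)
  \<comment> \<open>Viewing \<open>h\<close> as a density lets countable additivity of a measure sum
    the integrals over the disjoint intervals.\<close>
  define \<nu> where "\<nu> = density lborel (\<lambda>t. ennreal (h t) * indicator {a..b} t)"
  have hm[measurable]: "h \<in> borel_measurable borel"
    by (rule borel_measurable_continuous_onI[OF h(1)])
  have int: "(h has_integral integral S h) S" if "S = {x..y}" for S x y
    unfolding that by (intro integrable_integral integrable_continuous_real continuous_on_subset[OF h(1)]) auto
  have nu_space: "emeasure \<nu> UNIV = ennreal (integral {a..b} h)"
    unfolding \<nu>_def
    using nn_integral_has_integral_lebesgue'[OF h(2) int[OF refl, of a b]]
    by (subst emeasure_density) (auto cong: nn_integral_cong)
  have nu_ball: "emeasure \<nu> (cball \<theta> (s \<theta>)) = ennreal (integral (cball \<theta> (s \<theta>)) h)" if "\<theta> \<in> E" for \<theta>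
  proof -
    have "emeasure \<nu> (cball \<theta> (s \<theta>)) = (\<integral>\<^sup>+ t. ennreal (h t) * indicator (cball \<theta> (s \<theta>)) t \<partial>lborel)"
      unfolding \<nu>_def using sub[OF that]
      by (subst emeasure_density) (auto intro!: nn_integral_cong split: split_indicator simp: cb)
    also have "\<dots> = ennreal (integral (cball \<theta> (s \<theta>)) h)"
      by (rule nn_integral_has_integral_lebesgue'[OF h(2) int[OF cb]])
    finally show ?thesis .
  qed
  define X where "X n = (if n \<in> to_nat_on C ` C then cball (from_nat_into C n) (5 * s (from_nat_into C n)) else {})" for n
  define Y where "Y n = (if n \<in> to_nat_on C ` C then cball (from_nat_into C n) (s (from_nat_into C n)) else {})" for n
  have fC: "from_nat_into C n \<in> C" if "n \<in> to_nat_on C ` C" for n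
    using that C(1) by (auto)
  have XE: "(\<Union>i\<in>C. cball i (5 * s i)) \<subseteq> (\<Union>n. X n)"
  proof
    fix x assume "x \<in> (\<Union>i\<in>C. cball i (5 * s i))"
    then obtain i where "i \<in> C" "x \<in> cball i (5 * s i)" by auto
    then have "x \<in> X (to_nat_on C i)" using C(1) by (simp add: X_def)
    then show "x \<in> (\<Union>n. X n)" by blast
  qed
  have Xm: "range X \<subseteq> sets borel" "range Y \<subseteq> sets borel" by (auto simp: X_def Y_def)
  have dis: "disjoint_family Y"
    unfolding disjoint_family_on_def
  proof (intro ballI impI)
    fix m n :: nat assume mn: "m \<noteq> n"
    show "Y m \<inter> Y n = {}"
    proof (cases "m \<in> to_nat_on C ` C \<and> n \<in> to_nat_on C ` C")
      case True
      then have "from_nat_into C m \<noteq> from_nat_into C n"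
        using mn C(1) by (metis to_nat_on_from_nat_into)
      then have "disjnt (cball (from_nat_into C m) (s (from_nat_into C m))) (cball (from_nat_into C n) (s (from_nat_into C n)))"
        using C(3) fC True unfolding pairwise_def by blast
      then show ?thesis using True by (simp add: Y_def disjnt_def)
    qed (auto simp: Y_def)
  qed
  have XY: "emeasure lborel (X n) \<le> ennreal (5 / c) * emeasure \<nu> (Y n)" for n
  proof (cases "n \<in> to_nat_on C ` C")
    case True
    define \<theta> where "\<theta> = from_nat_into C n"
    have th: "\<theta> \<in> E" using fC[OF True] C(2) by (auto simp: \<theta>_def)
    have "emeasure lborel (X n) = ennreal (10 * s \<theta>)"
      using True s[OF th] by (simp add: X_def \<theta>_def[symmetric] cb)
    also have "\<dots> \<le> ennreal (5 / c * integral (cball \<theta> (s \<theta>)) h)"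
      using big[OF th] c unfolding cb by (intro ennreal_leI) (simp add: field_simps)
    also have "\<dots> = ennreal (5 / c) * emeasure \<nu> (cball \<theta> (s \<theta>))"
      using ennreal_mult'[of "5 / c"] c by (simp only: nu_ball[OF th]) simp
    also have "\<dots> = ennreal (5 / c) * emeasure \<nu> (Y n)"
      using True by (simp add: Y_def \<theta>_def)
    finally show ?thesis .
  qed (simp add: X_def)
  show thesis
  proof
    show "(\<Union>n. X n) \<in> sets borel" using Xm by blast
    show "E \<subseteq> (\<Union>n. X n)" using C(4) XE by blast
    have "emeasure lborel (\<Union>n. X n) \<le> (\<Sum>n. emeasure lborel (X n))"
      by (rule emeasure_subadditive_countably) (use Xm in auto)
    also have "\<dots> \<le> (\<Sum>n. ennreal (5 / c) * emeasure \<nu> (Y n))"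
      by (intro suminf_le XY) auto
    also have "\<dots> = ennreal (5 / c) * (\<Sum>n. emeasure \<nu> (Y n))"
      by simp
    also have "(\<Sum>n. emeasure \<nu> (Y n)) = emeasure \<nu> (\<Union>n. Y n)"
      by (rule suminf_emeasure) (use Xm dis in \<open>auto simp: \<nu>_def\<close>)
    also have "\<dots> \<le> emeasure \<nu> UNIV"
      by (rule emeasure_mono) (auto simp: \<nu>_def)
    also have "ennreal (5 / c) * emeasure \<nu> UNIV = ennreal (5 / c * integral {a..b} h)"
      using ennreal_mult'[of "5 / c"] c by (simp only: nu_space) simp
    finally show "emeasure lborel (\<Union>n. X n) \<le> ennreal (5 / c * integral {a..b} h)"
      by (simp add: mult_left_mono)
  qed
qed

subsection \<open>Radial limits of bounded analytic functions\<close>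

lemma integral_circle_monomials:
  "(LINT \<xi>|circle_measure. \<xi> ^ m * cnj (\<xi> ^ n)) = (if m = n then 1 else 0)"
proof -
  have pow: "(LINT \<xi>|circle_measure. \<xi> ^ k) = 0" if "k > 0" for k :: nat
  proof -
    have "(LINT \<xi>|circle_measure. \<xi> ^ k) = (LINT \<xi>|circle_measure. \<xi> ^ k * \<xi> / (\<xi> - 0))"
      by (intro Bochner_Integration.integral_cong) auto
    also have "\<dots> = 0"
      by (subst Cauchy_integral_circle) (use that in \<open>auto intro!: continuous_intros holomorphic_intros\<close>)
    finally show ?thesis .
  qed
  have x: "\<xi> ^ k * cnj (\<xi> ^ k) = 1" if "\<xi> \<in> space circle_measure" for \<xi> and k :: nat
    using that by (simp only: complex_norm_square[symmetric] norm_power) simp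
  consider "m = n" | "m > n" | "n > m" by linarith
  then show ?thesis
  proof cases
    case 1
    then have "(LINT \<xi>|circle_measure. \<xi> ^ m * cnj (\<xi> ^ n)) = (LINT \<xi>|circle_measure. 1)"
      using x by (intro Bochner_Integration.integral_cong) auto
    then show ?thesis using 1 by (simp add: measure_circle_space)
  next
    case 2
    then have "(LINT \<xi>|circle_measure. \<xi> ^ m * cnj (\<xi> ^ n)) = (LINT \<xi>|circle_measure. \<xi> ^ (m - n))"
    proof (intro Bochner_Integration.integral_cong refl)
      fix \<xi> assume \<xi>: "\<xi> \<in> space circle_measure"
      have "\<xi> ^ m = \<xi> ^ (m - n) * \<xi> ^ n" using 2 by (simp flip: power_add)
      then show "\<xi> ^ m * cnj (\<xi> ^ n) = \<xi> ^ (m - n)"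
        using x[OF \<xi>, of n] by (simp add: mult.assoc)
    qed
    then show ?thesis using pow[of "m - n"] 2 by simp
  next
    case 3
    then have "(LINT \<xi>|circle_measure. \<xi> ^ m * cnj (\<xi> ^ n)) = (LINT \<xi>|circle_measure. cnj (\<xi> ^ (n - m)))"
    proof (intro Bochner_Integration.integral_cong refl)
      fix \<xi> assume \<xi>: "\<xi> \<in> space circle_measure"
      have "\<xi> ^ n = \<xi> ^ m * \<xi> ^ (n - m)" using 3 by (simp flip: power_add)
      then show "\<xi> ^ m * cnj (\<xi> ^ n) = cnj (\<xi> ^ (n - m))"
        using x[OF \<xi>, of m] by (simp add: mult.assoc[symmetric])
    qed
    also have "\<dots> = cnj (LINT \<xi>|circle_measure. \<xi> ^ (n - m))" by (rule Bochner_Integration.integral_cnj)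
    finally show ?thesis using pow[of "n - m"] 3 by simp
  qed
qed

lemma Parseval_circle_polynomial:
  assumes "finite S"
  shows "(LINT \<xi>|circle_measure. (norm (\<Sum>n\<in>S. c n * \<xi> ^ n))\<^sup>2) = (\<Sum>n\<in>S. (norm (c n))\<^sup>2)"
proof -
  have "complex_of_real (LINT \<xi>|circle_measure. (norm (\<Sum>n\<in>S. c n * \<xi> ^ n))\<^sup>2)
      = (LINT \<xi>|circle_measure. complex_of_real ((norm (\<Sum>n\<in>S. c n * \<xi> ^ n))\<^sup>2))"
    by (rule integral_complex_of_real[symmetric])
  also have "\<dots> = (LINT \<xi>|circle_measure. (\<Sum>m\<in>S. \<Sum>n\<in>S. (c m * cnj (c n)) * (\<xi> ^ m * cnj (\<xi> ^ n))))"
    by (simp only: complex_norm_square) (simp add: sum_product mult_ac)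
  also have "\<dots> = (\<Sum>m\<in>S. \<Sum>n\<in>S. (LINT \<xi>|circle_measure. (c m * cnj (c n)) * (\<xi> ^ m * cnj (\<xi> ^ n))))"
    by (subst Bochner_Integration.integral_sum | intro Bochner_Integration.integrable_sum integrable_circle_continuous continuous_intros sum.cong refl)+
  also have "\<dots> = (\<Sum>m\<in>S. \<Sum>n\<in>S. (c m * cnj (c n)) * (if m = n then 1 else 0))"
    by (simp only: integral_mult_right_zero integral_circle_monomials)
  also have "\<dots> = (\<Sum>m\<in>S. complex_of_real ((norm (c m))\<^sup>2))"
  proof (intro sum.cong refl)
    fix m assume "m \<in> S"
    have "(\<Sum>n\<in>S. (c m * cnj (c n)) * (if m = n then 1 else 0)) = (\<Sum>n\<in>S. if m = n then c m * cnj (c n) else 0)"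
      by (intro sum.cong) auto
    also have "\<dots> = c m * cnj (c m)" using assms \<open>m \<in> S\<close> by simp
    finally show "(\<Sum>n\<in>S. (c m * cnj (c n)) * (if m = n then 1 else 0)) = complex_of_real ((norm (c m))\<^sup>2)"
      by (simp only: complex_norm_square)
  qed
  also have "\<dots> = complex_of_real (\<Sum>m\<in>S. (norm (c m))\<^sup>2)"
    by (rule of_real_sum[symmetric])
  finally show ?thesis by (simp only: of_real_eq_iff)
qed

text \<open>By Parseval the Taylor remainders are small in \<open>L\<^sup>2\<close> uniformly over all circles, and
  \<open>x \<le> e / 2 + x\<^sup>2 / (2 * e)\<close> turns this into an \<open>L\<^sup>1\<close> bound.\<close>

lemma bounded_analytic_approx_polynomial:
  assumes hol: "f holomorphic_on ball 0 1" and bd: "\<And>z. norm z < 1 \<Longrightarrow> norm (f z) \<le> B"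
    and e: "0 < e"
  obtains p where "p holomorphic_on UNIV"
    "\<And>c. norm c < 1 \<Longrightarrow> (LINT \<xi>|circle_measure. norm (f (c * \<xi>) - p (c * \<xi>))) \<le> e"
proof -
  define a where "a n = (deriv ^^ n) f 0 / fact n" for n
  have sums: "(\<lambda>n. a n * z ^ n) sums f z" if "norm z < 1" for z
    using holomorphic_power_series[OF hol, of z] that by (simp add: a_def)
  define p where "p N z = (\<Sum>n<N. a n * z ^ n)" for N z
  have pc: "continuous_on A (\<lambda>\<xi>. p N (c * \<xi>))" for A N c
    unfolding p_def by (intro continuous_intros)
  have fc: "continuous_on (sphere 0 1) (\<lambda>\<xi>. f (c * \<xi>))" if "norm c < 1" for c
    by (rule continuous_on_compose2[OF holomorphic_on_imp_continuous_on[OF hol]])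
       (use that in \<open>auto intro!: continuous_intros simp: norm_mult\<close>)
  have par: "(LINT \<xi>|circle_measure. (norm (p K (c * \<xi>) - p N (c * \<xi>)))\<^sup>2) = (\<Sum>n=N..<K. (norm (a n))\<^sup>2 * norm c ^ (2*n))"
    if "N \<le> K" for N K c
  proof -
    have "p K (c * \<xi>) - p N (c * \<xi>) = (\<Sum>n=N..<K. (a n * c ^ n) * \<xi> ^ n)" for \<xi>
    proof -
      have "p K (c * \<xi>) = p N (c * \<xi>) + (\<Sum>n=N..<K. a n * (c * \<xi>) ^ n)"
        unfolding p_def using that by (metis atLeast0LessThan le0 sum.atLeastLessThan_concat)
      then show ?thesis by (simp add: power_mult_distrib mult.assoc)
    qed
    then show ?thesis
      by (simp add: Parseval_circle_polynomial norm_mult norm_power power_mult_distrib power_even_eq)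
  qed
  \<comment> \<open>The Parseval identity for partial sums, with \<open>K\<close> sent to infinity.
    Absolute convergence of the Taylor series at a radius \<open>x\<close> strictly between
    \<open>norm c\<close> and \<open>1\<close> supplies the constant \<open>M\<close> that dominates
    all partial sums on the circle.\<close>
  have lim: "(\<lambda>K. \<Sum>n=N..<K. (norm (a n))\<^sup>2 * norm c ^ (2*n)) \<longlonglongrightarrow>
       (LINT \<xi>|circle_measure. (norm (f (c * \<xi>) - p N (c * \<xi>)))\<^sup>2)" if c: "norm c < 1" for N c
  proof -
    obtain x :: real where x: "norm c < x" "x < 1" using dense c by blast
    have x0: "0 \<le> x" using x norm_ge_zero order_trans less_imp_le by metis
    have sm: "summable (\<lambda>n. norm (a n * c ^ n))"
      by (rule powser_insidea[of a "complex_of_real x"]) (use sums[of "of_real x"] x x0 in \<open>auto dest: sums_summable\<close>)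
    define M where "M = (\<Sum>n. norm (a n * c ^ n))"
    have pM: "norm (p K (c * \<xi>)) \<le> M" if "\<xi> \<in> space circle_measure" for K \<xi>
    proof -
      have "norm (p K (c * \<xi>)) \<le> (\<Sum>n<K. norm (a n * (c * \<xi>) ^ n))"
        unfolding p_def by (rule norm_sum)
      also have "\<dots> = (\<Sum>n<K. norm (a n * c ^ n))"
        using that by (simp add: norm_mult norm_power)
      also have "\<dots> \<le> M" unfolding M_def by (rule sum_le_suminf[OF sm]) auto
      finally show ?thesis .
    qed
    have "(\<lambda>K. LINT \<xi>|circle_measure. (norm (p K (c * \<xi>) - p N (c * \<xi>)))\<^sup>2) \<longlonglongrightarrow>
       (LINT \<xi>|circle_measure. (norm (f (c * \<xi>) - p N (c * \<xi>)))\<^sup>2)"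
    proof (rule integral_dominated_convergence[where w = "\<lambda>_. (2 * M)\<^sup>2"])
      show "AE \<xi> in circle_measure. (\<lambda>K. (norm (p K (c * \<xi>) - p N (c * \<xi>)))\<^sup>2) \<longlonglongrightarrow> (norm (f (c * \<xi>) - p N (c * \<xi>)))\<^sup>2"
      proof (rule AE_I2)
        fix \<xi> assume "\<xi> \<in> space circle_measure"
        then have "norm (c * \<xi>) < 1" using c by (simp add: norm_mult)
        then have "(\<lambda>K. p K (c * \<xi>)) \<longlonglongrightarrow> f (c * \<xi>)"
          using sums unfolding p_def sums_def by blast
        then show "(\<lambda>K. (norm (p K (c * \<xi>) - p N (c * \<xi>)))\<^sup>2) \<longlonglongrightarrow> (norm (f (c * \<xi>) - p N (c * \<xi>)))\<^sup>2"
          by (intro tendsto_intros)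
      qed
      show "AE \<xi> in circle_measure. norm ((norm (p K (c * \<xi>) - p N (c * \<xi>)))\<^sup>2) \<le> (2 * M)\<^sup>2" for K
      proof (rule AE_I2)
        fix \<xi> assume \<xi>: "\<xi> \<in> space circle_measure"
        have "norm (p K (c * \<xi>) - p N (c * \<xi>)) \<le> norm (p K (c * \<xi>)) + norm (p N (c * \<xi>))"
          by (rule norm_triangle_ineq4)
        also have "\<dots> \<le> 2 * M" using pM[OF \<xi>, of K] pM[OF \<xi>, of N] by simp
        finally show "norm ((norm (p K (c * \<xi>) - p N (c * \<xi>)))\<^sup>2) \<le> (2 * M)\<^sup>2"
          using power_mono[of _ "2 * M" 2] by simp
      qed
    qed (auto intro!: borel_measurable_circle_continuous continuous_intros pc fc c)
    moreover have "\<forall>\<^sub>F K in sequentially. (LINT \<xi>|circle_measure. (norm (p K (c * \<xi>) - p N (c * \<xi>)))\<^sup>2) = (\<Sum>n=N..<K. (norm (a n))\<^sup>2 * norm c ^ (2*n))"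
      using eventually_ge_at_top[of N] by eventually_elim (rule par)
    ultimately show ?thesis by (rule Lim_transform_eventually)
  qed
  \<comment> \<open>Bessel's inequality: with \<open>N = 0\<close> the polynomial \<open>p 0\<close>
    vanishes, so the weighted sums are bounded by the mean of \<open>(norm f)\<^sup>2\<close>, hence
    by \<open>B\<^sup>2\<close>; then the radius tends to \<open>1\<close>. Square summability makes
    the tails small independently of \<open>c\<close>, since the powers of \<open>norm c\<close> are
    at most \<open>1\<close>.\<close>
  have part: "(\<Sum>n<K. (norm (a n))\<^sup>2) \<le> B\<^sup>2" for K
  proof -
    define r where "r k = 1 - 1 / real (k + 2)" for k
    have r: "0 \<le> r k" "r k < 1" for k by (auto simp: r_def)
    have rl: "r \<longlonglongrightarrow> 1 - 0" unfolding r_def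
      by (intro tendsto_intros LIMSEQ_ignore_initial_segment[of "\<lambda>n. 1 / real n"] lim_1_over_n)
    have "(\<Sum>n<K. (norm (a n))\<^sup>2 * r k ^ (2*n)) \<le> B\<^sup>2" for k
    proof -
      have "(\<Sum>n=0..<K. (norm (a n))\<^sup>2 * r k ^ (2*n)) \<le> (LINT \<xi>|circle_measure. (norm (f (r k * \<xi>) - p 0 (r k * \<xi>)))\<^sup>2)"
      proof (rule incseq_le)
        show "(\<lambda>K. \<Sum>n=0..<K. (norm (a n))\<^sup>2 * r k ^ (2*n)) \<longlonglongrightarrow> (LINT \<xi>|circle_measure. (norm (f (r k * \<xi>) - p 0 (r k * \<xi>)))\<^sup>2)"
          using lim[of "of_real (r k)" 0] r[of k] by simp
        show "incseq (\<lambda>K. \<Sum>n=0..<K. (norm (a n))\<^sup>2 * r k ^ (2*n))"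
          using r[of k] by (intro incseq_SucI) simp
      qed
      also have "\<dots> \<le> (LINT \<xi>|circle_measure. B\<^sup>2)"
      proof (rule integral_mono)
        fix \<xi> assume "\<xi> \<in> space circle_measure"
        then have "norm (f (r k * \<xi>)) \<le> B" using r[of k] by (intro bd) (simp add: norm_mult)
        then show "(norm (f (r k * \<xi>) - p 0 (r k * \<xi>)))\<^sup>2 \<le> B\<^sup>2"
          by (simp add: p_def power_mono)
      qed (use r[of k] in \<open>auto intro!: integrable_circle_continuous continuous_intros pc fc\<close>)
      finally show ?thesis by (simp add: measure_circle_space lessThan_atLeast0)
    qed
    moreover have "(\<lambda>k. \<Sum>n<K. (norm (a n))\<^sup>2 * r k ^ (2*n)) \<longlonglongrightarrow> (\<Sum>n<K. (norm (a n))\<^sup>2 * (1-0) ^ (2*n))"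
      by (intro tendsto_intros rl)
    ultimately have "(\<Sum>n<K. (norm (a n))\<^sup>2 * (1-0) ^ (2*n)) \<le> B\<^sup>2"
      by (intro LIMSEQ_le_const2) auto
    then show ?thesis by simp
  qed
  have sa: "summable (\<lambda>n. (norm (a n))\<^sup>2)"
    by (rule summableI_nonneg_bounded[OF _ part]) auto
  then obtain N where N: "\<And>K. K \<ge> N \<Longrightarrow> norm (\<Sum>n=N..<K. (norm (a n))\<^sup>2) < e\<^sup>2"
    using summable_Cauchy[of "\<lambda>n. (norm (a n))\<^sup>2"] e by (meson order_refl zero_less_power)
  show thesis
  proof
    show "p N holomorphic_on UNIV" unfolding p_def[abs_def] by (intro holomorphic_intros)
    fix c :: complex assume c: "norm c < 1"
    let ?u = "\<lambda>\<xi>. norm (f (c * \<xi>) - p N (c * \<xi>))"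
    have cu: "continuous_on (sphere 0 1) ?u" by (intro continuous_intros pc fc c)
    have "(LINT \<xi>|circle_measure. (?u \<xi>)\<^sup>2) \<le> e\<^sup>2"
    proof (rule LIMSEQ_le_const2[OF lim[OF c]], intro exI allI impI)
      fix K assume "N \<le> K"
      have "(\<Sum>n=N..<K. (norm (a n))\<^sup>2 * norm c ^ (2*n)) \<le> (\<Sum>n=N..<K. (norm (a n))\<^sup>2)"
        using c by (intro sum_mono mult_left_le power_le_one) auto
      also have "\<dots> \<le> e\<^sup>2" using N[OF \<open>N \<le> K\<close>] by simp
      finally show "(\<Sum>n=N..<K. (norm (a n))\<^sup>2 * norm c ^ (2*n)) \<le> e\<^sup>2" .
    qed
    have "(LINT \<xi>|circle_measure. ?u \<xi>) \<le> (LINT \<xi>|circle_measure. e / 2 + (?u \<xi>)\<^sup>2 / (2 * e))"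
    proof (rule integral_mono)
      fix \<xi> :: complex
      have "0 \<le> (?u \<xi> - e)\<^sup>2 / (2 * e)" using e by simp
      also have "\<dots> = e / 2 + (?u \<xi>)\<^sup>2 / (2 * e) - ?u \<xi>"
        using e by (simp add: power2_eq_square field_simps)
      finally show "?u \<xi> \<le> e / 2 + (?u \<xi>)\<^sup>2 / (2 * e)" by simp
    qed (use e in \<open>auto intro!: integrable_circle_continuous continuous_intros cu\<close>)
    also have "\<dots> = e / 2 + (LINT \<xi>|circle_measure. (?u \<xi>)\<^sup>2) / (2 * e)"
      using e by (subst Bochner_Integration.integral_add)
        (auto intro!: integrable_circle_continuous continuous_intros cu simp: measure_circle_space)
    also have "\<dots> \<le> e / 2 + e\<^sup>2 / (2 * e)"
      using \<open>(LINT \<xi>|circle_measure. (?u \<xi>)\<^sup>2) \<le> e\<^sup>2\<close> e by (intro add_left_mono divide_right_mono) auto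
    also have "\<dots> = e" using e by (simp add: power2_eq_square field_simps)
    finally show "(LINT \<xi>|circle_measure. ?u \<xi>) \<le> e" .
  qed
qed

text \<open>The weak type estimate for the radial maximal function. The constant \<open>10\<close>
  is Vitali's \<open>5\<close> times \<open>2\<close>: arcs of half-length up to \<open>pi\<close>
  about angles in \<open>{0..2*pi}\<close> lie in \<open>{-pi..3*pi}\<close>, which runs around the
  circle twice.\<close>

lemma emeasure_radial_maximal_le:
  assumes g: "g holomorphic_on ball 0 1" and c: "0 < c"
    and L1: "\<And>\<zeta>. norm \<zeta> < 1 \<Longrightarrow> (LINT \<xi>|circle_measure. norm (g (\<zeta> * \<xi>))) \<le> e"
  shows "{\<xi> \<in> sphere 0 1. \<exists>r\<in>{0..<1}. c < norm (g (complex_of_real r * \<xi>))} \<in> sets circle_measure" (is "?E \<in> _")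
    and "emeasure circle_measure {\<xi> \<in> sphere 0 1. \<exists>r\<in>{0..<1}. c < norm (g (complex_of_real r * \<xi>))} \<le> ennreal (10 * e / c)"
proof -
  define \<rho> where "\<rho> k = 1 - 1 / real (k + 2)" for k
  have \<rho>: "0 < \<rho> k" "\<rho> k < 1" for k by (auto simp: \<rho>_def)
  have \<rho>l: "\<rho> \<longlonglongrightarrow> 1 - 0" unfolding \<rho>_def
    by (intro tendsto_intros LIMSEQ_ignore_initial_segment[of "\<lambda>n. 1 / real n"] lim_1_over_n)
  \<comment> \<open>Restricting the radii to \<open>r < \<rho> k\<close> allows \<open>g\<close> to
    be replaced by its dilate by \<open>\<rho> k\<close>, which is continuous on the closed disk.
    The sets increase to the full one, and the bound does not depend on \<open>k\<close>.\<close>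
  define E where "E k = {\<xi> \<in> sphere 0 1. \<exists>r\<in>{0..<\<rho> k}. c < norm (g (complex_of_real r * \<xi>))}" for k
  have gr: "continuous_on (sphere 0 1) (\<lambda>\<xi>. norm (g (complex_of_real r * \<xi>)))" if "r \<in> {0..<1}" for r
    by (rule continuous_on_norm, rule continuous_on_compose2[OF holomorphic_on_imp_continuous_on[OF g]])
       (use that in \<open>auto intro!: continuous_intros simp: norm_mult\<close>)
  have Em: "E k \<in> sets circle_measure" for k
  proof -
    \<comment> \<open>Uncountably many radii are involved, so measurability comes from openness:
      each radius contributes a relatively open set.\<close>
    have "openin (top_of_set (sphere 0 1)) (E k)"
    proof -
      have "E k = (\<Union>r\<in>{0..<\<rho> k}. sphere 0 1 \<inter> (\<lambda>\<xi>. norm (g (complex_of_real r * \<xi>))) -` {c<..})"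
        by (auto simp: E_def)
      moreover have "openin (top_of_set (sphere 0 1)) (sphere 0 1 \<inter> (\<lambda>\<xi>. norm (g (complex_of_real r * \<xi>))) -` {c<..})"
        if "r \<in> {0..<\<rho> k}" for r
        by (rule continuous_openin_preimage_gen[OF gr]) (use that \<rho>(2)[of k] in auto)
      ultimately show ?thesis by (simp only:) (rule openin_Union, blast)
    qed
    then obtain T where "open T" "E k = sphere 0 1 \<inter> T" by (auto simp: openin_open)
    then show ?thesis by (auto simp: sets_restrict_space)
  qed
  have incE: "incseq E"
  proof -
    have \<rho>m: "\<rho> m \<le> \<rho> n" if "m \<le> n" for m n
      using that by (simp add: \<rho>_def field_simps)
    show ?thesis
    proof (intro monoI subsetI)
      fix m n \<xi> assume "m \<le> n" "\<xi> \<in> E m"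
      then obtain r where "\<xi> \<in> sphere 0 1" "0 \<le> r" "r < \<rho> m" "c < norm (g (complex_of_real r * \<xi>))"
        unfolding E_def by auto
      then show "\<xi> \<in> E n" using \<rho>m[OF \<open>m \<le> n\<close>] unfolding E_def by auto
    qed
  qed
  have UE: "?E = (\<Union>k. E k)"
  proof -
    have "\<exists>k. r < \<rho> k" if "r < 1" for r
      using order_tendstoD(1)[OF \<rho>l, of r] that by (auto simp: eventually_sequentially)
    moreover have "r < 1" if "r < \<rho> k" for r k using that \<rho>(2)[of k] by simp
    ultimately show ?thesis
    proof (intro subset_antisym subsetI)
      fix \<xi> assume "\<xi> \<in> ?E"
      then obtain r where r: "\<xi> \<in> sphere 0 1" "0 \<le> r" "r < 1" "c < norm (g (complex_of_real r * \<xi>))" by auto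
      then obtain k where "r < \<rho> k" using \<open>\<And>r. r < 1 \<Longrightarrow> \<exists>k. r < \<rho> k\<close> by blast
      then have "\<xi> \<in> E k" using r unfolding E_def by auto
      then show "\<xi> \<in> (\<Union>k. E k)" by blast
    next
      fix \<xi> assume "\<xi> \<in> (\<Union>k. E k)"
      then obtain k r where r: "\<xi> \<in> sphere 0 1" "0 \<le> r" "r < \<rho> k" "c < norm (g (complex_of_real r * \<xi>))"
        unfolding E_def by auto
      then show "\<xi> \<in> ?E" using \<rho>(2)[of k] by auto
    qed
  qed
  have bound: "emeasure circle_measure (E k) \<le> ennreal (10 * e / c)" for k
  proof -
    define G where "G z = g (of_real (\<rho> k) * z)" for z
    have sc: "norm (complex_of_real (\<rho> k) * z) < 1" if "norm z \<le> 1" for z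
    proof -
      have "norm (complex_of_real (\<rho> k) * z) \<le> \<rho> k * 1"
        unfolding norm_mult using \<rho>[of k] that by (intro mult_mono) auto
      then show ?thesis using \<rho>(2)[of k] by simp
    qed
    have G1: "continuous_on (cball 0 1) G"
      unfolding G_def
      by (rule continuous_on_compose2[OF holomorphic_on_imp_continuous_on[OF g]])
         (use sc in \<open>auto intro!: continuous_intros\<close>)
    have G2: "G holomorphic_on ball 0 1"
      unfolding G_def
      by (rule holomorphic_on_compose_gen[OF _ g, unfolded o_def])
         (use sc in \<open>auto intro!: holomorphic_intros\<close>)
    define h where "h t = norm (G (cis t))" for t
    have h: "continuous_on A h" for A
      unfolding h_def by (intro continuous_intros continuous_on_compose2[OF G1]) auto
    define E' where "E' = {0..2*pi} \<inter> cis -` E k"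
    have "\<exists>s. 0 < s \<and> s \<le> pi \<and> 2 * s * c \<le> integral {\<theta>-s..\<theta>+s} h" if "\<theta> \<in> E'" for \<theta>
    proof (rule ccontr)
      assume "\<nexists>s. 0 < s \<and> s \<le> pi \<and> 2 * s * c \<le> integral {\<theta>-s..\<theta>+s} h"
      then have avg: "integral {\<theta>-s..\<theta>+s} (\<lambda>t. norm (G (cis t))) \<le> 2 * s * c" if "0 < s" "s \<le> pi" for s
        using that unfolding h_def by fastforce
      obtain r where r: "0 \<le> r" "r < \<rho> k" "c < norm (g (of_real r * cis \<theta>))"
        using \<open>\<theta> \<in> E'\<close> by (auto simp: E'_def E_def)
      have "norm (G (of_real (r / \<rho> k) * cis \<theta>)) \<le> c"
        by (rule Poisson_circle_average_le[OF G1 G2]) (use r \<rho>[of k] avg in auto)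
      moreover have "G (of_real (r / \<rho> k) * cis \<theta>) = g (of_real r * cis \<theta>)"
        unfolding G_def using \<rho>(1)[of k] by (simp flip: mult.assoc)
      ultimately show False using r(3) by simp
    qed
    then obtain s where s: "\<And>\<theta>. \<theta> \<in> E' \<Longrightarrow> 0 < s \<theta> \<and> s \<theta> \<le> pi \<and> 2 * s \<theta> * c \<le> integral {\<theta> - s \<theta>..\<theta> + s \<theta>} h"
      by metis
    obtain A where A: "A \<in> sets borel" "E' \<subseteq> A" "emeasure lborel A \<le> ennreal (5 / c * integral {-pi..3*pi} h)"
    proof (rule weak_type_centered_averages[of h c E' s pi "-pi" "3*pi"])
      show "{\<theta> - s \<theta>..\<theta> + s \<theta>} \<subseteq> {-pi..3*pi}" if "\<theta> \<in> E'" for \<theta>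
        using s[OF that] that by (auto simp: E'_def)
    qed (use c h s in \<open>auto simp: h_def\<close>)
    \<comment> \<open>Each half of \<open>{-pi..3*pi}\<close> is a full turn. Shifting it to
      \<open>{0..2*pi}\<close> introduces a sign, which the complex dilation factor in
      \<open>L1\<close> absorbs.\<close>
    have half: "integral {-pi..pi} (\<lambda>t. h (t + a)) \<le> 2 * pi * e" if a: "cis a = 1" for a
    proof -
      have cc: "continuous_on (sphere 0 1) (\<lambda>\<xi>. norm (G (- \<xi>)))"
        by (intro continuous_intros continuous_on_compose2[OF G1]) auto
      have "cis (t - pi + a) = - cis t" for t
      proof -
        have "cis (t - pi + a) = cis t * cis a * cis (-pi)" by (simp add: cis_mult algebra_simps)
        then show ?thesis using a by (simp add: cis_conv_exp[of "-pi"] exp_minus)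
      qed
      then have "integral {0..2*pi} (\<lambda>t. h (t - pi + a)) = 2 * pi * (LINT \<xi>|circle_measure. norm (G (- \<xi>)))"
        using has_integral_circle[OF cc] by (simp add: h_def integral_unique)
      also have "integral {0..2*pi} (\<lambda>t. h (t - pi + a)) = integral {-pi..pi} (\<lambda>t. h (t + a))"
        using integral_shift_real_ivl[of "-pi" "-pi" pi "\<lambda>t. h (t + a)"] by simp
      also have "(LINT \<xi>|circle_measure. norm (G (- \<xi>))) \<le> e"
        using L1[of "- of_real (\<rho> k)"] \<rho>[of k] by (simp add: G_def)
      finally show ?thesis by simp
    qed
    have "integral {-pi..3*pi} h = integral {-pi..pi} h + integral {pi..3*pi} h"
      by (rule Henstock_Kurzweil_Integration.integral_combine[symmetric])
         (auto intro: integrable_continuous_real h)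
    also have "integral {pi..3*pi} h = integral {-pi..pi} (\<lambda>t. h (t + 2*pi))"
      using integral_shift_real_ivl[of pi "2*pi" "3*pi" h] by simp
    finally have tot: "integral {-pi..3*pi} h \<le> 4 * pi * e"
      using half[of 0] half[of "2*pi"] by simp
    have "emeasure circle_measure (E k) = emeasure lborel E' / ennreal (2*pi)"
      unfolding E'_def by (rule emeasure_circle_measure[OF Em])
    also have "\<dots> \<le> ennreal (5 / c * (4 * pi * e)) / ennreal (2*pi)"
    proof (rule divide_right_mono_ennreal)
      have "emeasure lborel E' \<le> emeasure lborel A" by (rule emeasure_mono) (use A in auto)
      also note A(3)
      also have "ennreal (5 / c * integral {-pi..3*pi} h) \<le> ennreal (5 / c * (4 * pi * e))"
        using tot c by (intro ennreal_leI mult_left_mono) auto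
      finally show "emeasure lborel E' \<le> ennreal (5 / c * (4 * pi * e))" .
    qed
    also have "\<dots> = ennreal (10 * e / c)"
    proof -
      have "0 \<le> e" using L1[of 0] by (rule order_trans[rotated]) auto
      then show ?thesis using c by (subst divide_ennreal) auto
    qed
    finally show ?thesis .
  qed
  show "?E \<in> sets circle_measure" unfolding UE using Em by blast
  have "emeasure circle_measure ?E = (SUP k. emeasure circle_measure (E k))"
    unfolding UE by (rule SUP_emeasure_incseq[symmetric]) (use Em incE in auto)
  also have "\<dots> \<le> ennreal (10 * e / c)" by (intro SUP_least bound)
  finally show "emeasure circle_measure ?E \<le> ennreal (10 * e / c)" .
qed

text \<open>At almost every \<open>\<xi>\<close>, for every \<open>j\<close> one of the approximants
  stays within \<open>1 / (j + 1)\<close> of \<open>f\<close> along the entire radius. Approximants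
  are entire and so have radial limits, and uniform convergence along the radius passes this on to
  \<open>f\<close>.\<close>

theorem Fatou_radial_limit:
  assumes "bounded_analytic f"
  shows "AE \<xi> in circle_measure. \<exists>l. ((\<lambda>r. f (complex_of_real r * \<xi>)) \<longlongrightarrow> l) (at_left 1)"
proof -
  have hol: "f holomorphic_on ball 0 1" using assms by (simp add: bounded_analytic_def)
  obtain B where B: "\<And>z. norm z < 1 \<Longrightarrow> norm (f z) \<le> B"
    using assms unfolding bounded_analytic_def bounded_iff by fastforce
  have "\<exists>p. p holomorphic_on UNIV \<and>
      (\<forall>c. norm c < 1 \<longrightarrow> (LINT \<xi>|circle_measure. norm (f (c * \<xi>) - p (c * \<xi>))) \<le> 1 / real (N + 1))" for N
    by (rule bounded_analytic_approx_polynomial[OF hol B, of "1 / real (N + 1)"]) auto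
  then obtain p where p: "\<And>N. p N holomorphic_on UNIV"
      "\<And>N c. norm c < 1 \<Longrightarrow> (LINT \<xi>|circle_measure. norm (f (c * \<xi>) - p N (c * \<xi>))) \<le> 1 / real (N + 1)"
    by metis
  \<comment> \<open>The weak type bound for \<open>E j N\<close> is
    \<open>10 * (j + 1) / (N + 1)\<close>. For fixed \<open>j\<close> it tends to \<open>0\<close>
    with \<open>N\<close>, so the points that are bad for every \<open>N\<close> form a null
    set.\<close>
  define E where "E j N = {\<xi> \<in> sphere 0 1. \<exists>r\<in>{0..<1}. 1 / real (j + 1) <
     norm (f (complex_of_real r * \<xi>) - p N (complex_of_real r * \<xi>))}" for j N
  have hd: "(\<lambda>z. f z - p N z) holomorphic_on ball 0 1" for N
    by (intro holomorphic_intros hol holomorphic_on_subset[OF p(1)]) auto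
  have Em: "E j N \<in> sets circle_measure" for j N
    unfolding E_def by (rule emeasure_radial_maximal_le(1)[OF hd _ p(2)]) auto
  have Eb: "emeasure circle_measure (E j N) \<le> ennreal (10 * (1 / real (N + 1)) / (1 / real (j + 1)))" for j N
    unfolding E_def by (rule emeasure_radial_maximal_le(2)[OF hd _ p(2)]) auto
  have null: "(\<Inter>N. E j N) \<in> null_sets circle_measure" for j
  proof (rule null_setsI)
    show m: "(\<Inter>N. E j N) \<in> sets circle_measure" using Em by blast
    have "emeasure circle_measure (\<Inter>N. E j N) \<le> ennreal (10 * real (j + 1) * (1 / real (N + 1)))" for N
    proof -
      have "emeasure circle_measure (\<Inter>N. E j N) \<le> emeasure circle_measure (E j N)"
        by (rule emeasure_mono) (use Em in auto)
      also note Eb[of j N]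
      finally show ?thesis by simp
    qed
    moreover have "(\<lambda>N. ennreal (10 * real (j + 1) * (1 / real (N + 1)))) \<longlonglongrightarrow> ennreal (10 * real (j + 1) * 0)"
      by (intro tendsto_ennrealI tendsto_intros LIMSEQ_ignore_initial_segment[of "\<lambda>n. 1 / real n"] lim_1_over_n)
    ultimately have "emeasure circle_measure (\<Inter>N. E j N) \<le> ennreal (10 * real (j + 1) * 0)"
      by (intro LIMSEQ_le_const) auto
    then show "emeasure circle_measure (\<Inter>N. E j N) = 0" by simp
  qed
  then have "(\<Union>j. \<Inter>N. E j N) \<in> null_sets circle_measure" by blast
  then show ?thesis
  proof (rule AE_I')
    show "{\<xi> \<in> space circle_measure. \<nexists>l. ((\<lambda>r. f (complex_of_real r * \<xi>)) \<longlongrightarrow> l) (at_left 1)} \<subseteq> (\<Union>j. \<Inter>N. E j N)"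
    proof (rule ccontr)
      assume "\<not> ?thesis"
      then obtain \<xi> where x: "\<xi> \<in> space circle_measure" and no: "\<nexists>l. ((\<lambda>r. f (complex_of_real r * \<xi>)) \<longlongrightarrow> l) (at_left 1)"
        and "\<xi> \<notin> (\<Union>j. \<Inter>N. E j N)" by blast
      then have "\<forall>j. \<exists>N. \<xi> \<notin> E j N" by blast
      have \<xi>: "norm \<xi> = 1" using x by simp
      obtain N where N: "\<xi> \<notin> E j (N j)" for j
        using \<open>\<forall>j. \<exists>N. \<xi> \<notin> E j N\<close> by metis
      have close: "norm (f (complex_of_real r * \<xi>) - p (N j) (complex_of_real r * \<xi>)) \<le> 1 / real (j + 1)" if "r \<in> {0..<1}" for r j
        using N[of j] that \<xi> by (auto simp: E_def not_less)
      have plim: "((\<lambda>r. p (N j) (complex_of_real r * \<xi>)) \<longlongrightarrow> p (N j) \<xi>) (at_left 1)" for j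
      proof -
        have "isCont (p (N j)) \<xi>"
          using holomorphic_on_imp_continuous_on[OF p(1)] by (simp add: continuous_on_eq_continuous_at)
        moreover have "((\<lambda>r. complex_of_real r * \<xi>) \<longlongrightarrow> of_real 1 * \<xi>) (at_left 1)"
          by (intro tendsto_intros)
        ultimately show ?thesis using isCont_tendsto_compose by fastforce
      qed
      have ev: "\<forall>\<^sub>F r in at_left (1::real). r \<in> {0..<1}"
        using eventually_at_left_real[of 0 "1::real"] by (auto elim!: eventually_mono)
      \<comment> \<open>Both approximants are close to \<open>f\<close> at every point of the
        radius, so their values at the endpoint are close to each other. Thus the endpoint values
        form a Cauchy sequence, whose limit is the candidate for the radial limit of
        \<open>f\<close>.\<close>
      have pd: "norm (p (N i) \<xi> - p (N j) \<xi>) \<le> 1 / real (i + 1) + 1 / real (j + 1)" for i j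
      proof (rule tendsto_upperbound)
        show "((\<lambda>r. norm (p (N i) (complex_of_real r * \<xi>) - p (N j) (complex_of_real r * \<xi>))) \<longlongrightarrow> norm (p (N i) \<xi> - p (N j) \<xi>)) (at_left 1)"
          by (intro tendsto_intros plim)
        show "\<forall>\<^sub>F r in at_left 1. norm (p (N i) (complex_of_real r * \<xi>) - p (N j) (complex_of_real r * \<xi>)) \<le> 1 / real (i + 1) + 1 / real (j + 1)"
          using ev
        proof eventually_elim
          case (elim r)
          show ?case
            using close[OF elim, of i] close[OF elim, of j]
              norm_triangle_ineq4[of "f (complex_of_real r * \<xi>) - p (N j) (complex_of_real r * \<xi>)"
                "f (complex_of_real r * \<xi>) - p (N i) (complex_of_real r * \<xi>)"] by simp
        qed
      qed simp
      have z: "(\<lambda>j. 1 / real (j + 1)) \<longlonglongrightarrow> 0"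
        by (intro LIMSEQ_ignore_initial_segment[of "\<lambda>n. 1 / real n"] lim_1_over_n)
      have "Cauchy (\<lambda>j. p (N j) \<xi>)"
      proof (rule metric_CauchyI)
        fix e :: real assume "0 < e"
        then obtain M where M: "\<And>j. j \<ge> M \<Longrightarrow> 1 / real (j + 1) < e / 2"
          using order_tendstoD(2)[OF z, of "e / 2"] by (auto simp: eventually_sequentially)
        have "dist (p (N i) \<xi>) (p (N j) \<xi>) < e" if "i \<ge> M" "j \<ge> M" for i j
          using pd[of i j] M[OF that(1)] M[OF that(2)] by (simp add: dist_norm)
        then show "\<exists>M. \<forall>i\<ge>M. \<forall>j\<ge>M. dist (p (N i) \<xi>) (p (N j) \<xi>) < e" by blast
      qed
      then obtain l where l: "(\<lambda>j. p (N j) \<xi>) \<longlonglongrightarrow> l"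
        by (auto simp: Cauchy_convergent_iff convergent_def)
      have "((\<lambda>r. f (complex_of_real r * \<xi>)) \<longlongrightarrow> l) (at_left 1)"
      proof (rule swap_uniform_limit'[OF _ l _ ev])
        show "\<forall>\<^sub>F j in sequentially. ((\<lambda>r. p (N j) (complex_of_real r * \<xi>)) \<longlongrightarrow> p (N j) \<xi>) (at_left 1)"
          using plim by simp
        show "uniform_limit {0..<1} (\<lambda>j r. p (N j) (complex_of_real r * \<xi>)) (\<lambda>r. f (complex_of_real r * \<xi>)) sequentially"
        proof (rule uniform_limitI)
          fix e :: real assume "0 < e"
          then show "\<forall>\<^sub>F j in sequentially. \<forall>r\<in>{0..<1}. dist (p (N j) (complex_of_real r * \<xi>)) (f (complex_of_real r * \<xi>)) < e"
            using order_tendstoD(2)[OF z, of e]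
            by (auto elim!: eventually_mono simp: dist_norm norm_minus_commute intro: le_less_trans[OF close])
        qed
      qed simp
      then show False using no by blast
    qed
  qed
qed

subsection \<open>Herglotz integrals\<close>

definition Herglotz :: "(complex \<Rightarrow> real) \<Rightarrow> complex \<Rightarrow> complex" where
  "Herglotz W z = (LINT \<xi>|circle_measure. (\<xi> + z) / (\<xi> - z) * complex_of_real (W \<xi>))"

lemma integrable_circle_mult:
  fixes k :: "complex \<Rightarrow> 'b::{real_normed_algebra, banach, second_countable_topology}"
  assumes k: "continuous_on (sphere 0 1) k" and W: "integrable circle_measure W"
  shows "integrable circle_measure (\<lambda>\<xi>. k \<xi> * W \<xi>)"
proof -
  have "compact (k ` sphere 0 1)"
    by (rule compact_continuous_image[OF k]) simp
  then obtain B where B: "\<And>\<xi>. \<xi> \<in> sphere 0 1 \<Longrightarrow> norm (k \<xi>) \<le> B"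
    using compact_imp_bounded[of "k ` sphere 0 1"] unfolding bounded_iff by blast
  have [measurable]: "k \<in> borel_measurable circle_measure" "W \<in> borel_measurable circle_measure"
    using borel_measurable_circle_continuous[OF k] W by auto
  show ?thesis
  proof (rule Bochner_Integration.integrable_bound)
    show "integrable circle_measure (\<lambda>\<xi>. B * norm (W \<xi>))"
      by (intro integrable_mult_right integrable_norm W)
    show "AE \<xi> in circle_measure. norm (k \<xi> * W \<xi>) \<le> norm (B * norm (W \<xi>))"
    proof (rule AE_I2)
      fix \<xi> assume "\<xi> \<in> space circle_measure"
      then have "norm (k \<xi>) \<le> B" using B by simp
      then have "norm (k \<xi>) * norm (W \<xi>) \<le> B * norm (W \<xi>)" by (rule mult_right_mono) simp
      then show "norm (k \<xi> * W \<xi>) \<le> norm (B * norm (W \<xi>))"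
        using norm_mult_ineq[of "k \<xi>" "W \<xi>"] by simp
    qed
  qed measurable
qed

lemma continuous_on_Herglotz_kernel:
  fixes z :: complex
  shows "norm z < 1 \<Longrightarrow> continuous_on (sphere 0 1) (\<lambda>\<xi>. (\<xi> + z) / (\<xi> - z))"
  by (intro continuous_intros) auto

lemma integrable_Herglotz:
  "integrable circle_measure W \<Longrightarrow> norm z < 1 \<Longrightarrow>
    integrable circle_measure (\<lambda>\<xi>. (\<xi> + z) / (\<xi> - z) * complex_of_real (W \<xi>))"
  by (intro integrable_circle_mult continuous_on_Herglotz_kernel) auto

lemma integrable_Poisson:
  fixes W :: "complex \<Rightarrow> real"
  shows "integrable circle_measure W \<Longrightarrow> norm z < 1 \<Longrightarrow> integrable circle_measure (\<lambda>\<xi>. Poisson z \<xi> * W \<xi>)"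
  by (intro integrable_circle_mult continuous_on_Poisson) auto

lemma Re_Herglotz:
  assumes "integrable circle_measure W" "norm z < 1"
  shows "Re (Herglotz W z) = (LINT \<xi>|circle_measure. Poisson z \<xi> * W \<xi>)"
proof -
  have "Re (Herglotz W z) = (LINT \<xi>|circle_measure. Re ((\<xi> + z) / (\<xi> - z) * complex_of_real (W \<xi>)))"
    unfolding Herglotz_def by (rule integral_Re[OF integrable_Herglotz[OF assms], symmetric])
  also have "\<dots> = (LINT \<xi>|circle_measure. Poisson z \<xi> * W \<xi>)"
    by (intro Bochner_Integration.integral_cong) (auto simp: Re_Herglotz_kernel[symmetric] simp del: times_divide_eq_left times_divide_eq_right)
  finally show ?thesis .
qed

text \<open>For \<open>norm \<xi> = 1\<close> the kernel equals \<open>1\<close> plus twice the sum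
  of the positive powers of \<open>cnj \<xi> * z\<close>, because \<open>cnj \<xi>\<close> is the
  inverse of \<open>\<xi>\<close>. Integrating term by term gives a power series in
  \<open>z\<close>; the factors \<open>b n\<close> record the \<open>1\<close> and the
  \<open>2\<close>.\<close>

lemma holomorphic_Herglotz:
  assumes W: "integrable circle_measure W"
  shows "Herglotz W holomorphic_on ball 0 1"
proof (rule power_series_holomorphic)
  define b :: "nat \<Rightarrow> complex" where "b n = (if n = 0 then 1 else 2)" for n
  fix z :: complex assume "z \<in> ball 0 1"
  then have z: "norm z < 1" by simp
  let ?f = "\<lambda>n \<xi>. b n * (cnj \<xi> * z) ^ n * complex_of_real (W \<xi>)"
  have WC: "integrable circle_measure (\<lambda>\<xi>. complex_of_real (W \<xi>))" using W by simp
  have int: "integrable circle_measure (?f n)" for n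
    by (rule integrable_circle_mult[OF _ WC]) (intro continuous_intros)
  have nf: "norm (?f n \<xi>) \<le> 2 * norm z ^ n * \<bar>W \<xi>\<bar>" if "\<xi> \<in> space circle_measure" for n \<xi>
    using that by (auto simp: norm_mult norm_power b_def intro!: mult_right_mono)
  have gs: "summable (\<lambda>n. 2 * norm z ^ n * c)" for c
    using z by (intro summable_mult summable_mult2 summable_geometric) auto
  have sums: "(\<lambda>n. ?f n \<xi>) sums ((\<xi> + z) / (\<xi> - z) * complex_of_real (W \<xi>))" if "\<xi> \<in> space circle_measure" for \<xi>
  proof -
    have n: "norm \<xi> = 1" using that by simp
    then have x1: "\<xi> * cnj \<xi> = 1" by (simp only: complex_norm_square[symmetric]) simp
    have nx: "\<xi> \<noteq> z" using n z by auto
    have "norm (cnj \<xi> * z) < 1" using n z by (simp add: norm_mult)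
    then have "(\<lambda>n. 2 * (cnj \<xi> * z) ^ n - (if n = 0 then 1 else 0)) sums (2 * (1 / (1 - cnj \<xi> * z)) - 1)"
      using sums_single[of 0 "\<lambda>_. 1 :: complex"]
      by (intro sums_diff sums_mult geometric_sums) auto
    also have "(\<lambda>n. 2 * (cnj \<xi> * z) ^ n - (if n = 0 then 1 else 0)) = (\<lambda>n. b n * (cnj \<xi> * z) ^ n)"
      by (auto simp: b_def fun_eq_iff)
    also have "2 * (1 / (1 - cnj \<xi> * z)) - 1 = (\<xi> + z) / (\<xi> - z)"
    proof -
      have e: "\<xi> * (1 - cnj \<xi> * z) = \<xi> - z" using x1 by (simp add: algebra_simps)
      then have "1 / (1 - cnj \<xi> * z) = \<xi> / (\<xi> - z)"
        using nx n by (metis divide_divide_eq_right divide_self_if mult.commute nonzero_mult_div_cancel_left norm_zero times_divide_eq_right zero_neq_one)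
      then have "2 * (1 / (1 - cnj \<xi> * z)) - 1 = 2 * (\<xi> / (\<xi> - z)) - 1" by (simp only:)
      also have "\<dots> = (\<xi> + z) / (\<xi> - z)" using nx by (simp add: divide_simps)
      finally show ?thesis .
    qed
    finally show ?thesis by (rule sums_mult2)
  qed
  have "(\<lambda>n. integral\<^sup>L circle_measure (?f n)) sums (LINT \<xi>|circle_measure. (\<Sum>n. ?f n \<xi>))"
  proof (rule sums_integral[OF int])
    show "AE \<xi> in circle_measure. summable (\<lambda>n. norm (?f n \<xi>))"
      by (intro AE_I2 summable_comparison_test'[OF gs]) (use nf in auto)
    show "summable (\<lambda>n. LINT \<xi>|circle_measure. norm (?f n \<xi>))"
    proof (rule summable_comparison_test'[OF gs])
      fix n
      have "(LINT \<xi>|circle_measure. norm (?f n \<xi>)) \<le> (LINT \<xi>|circle_measure. 2 * norm z ^ n * \<bar>W \<xi>\<bar>)"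
        by (rule integral_mono) (use int W nf in auto)
      then show "norm (LINT \<xi>|circle_measure. norm (?f n \<xi>)) \<le> 2 * norm z ^ n * (LINT \<xi>|circle_measure. \<bar>W \<xi>\<bar>)"
        by simp
    qed
  qed
  also have "(LINT \<xi>|circle_measure. (\<Sum>n. ?f n \<xi>)) = Herglotz W z"
    unfolding Herglotz_def
    by (intro Bochner_Integration.integral_cong refl sums_unique[symmetric] sums)
  also have "(\<lambda>n. integral\<^sup>L circle_measure (?f n)) =
      (\<lambda>n. (LINT \<xi>|circle_measure. b n * cnj \<xi> ^ n * complex_of_real (W \<xi>)) * (z - 0) ^ n)"
  proof
    fix n
    have "?f n = (\<lambda>\<xi>. (b n * cnj \<xi> ^ n * complex_of_real (W \<xi>)) * z ^ n)"
      by (auto simp: power_mult_distrib mult_ac)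
    then show "integral\<^sup>L circle_measure (?f n) = (LINT \<xi>|circle_measure. b n * cnj \<xi> ^ n * complex_of_real (W \<xi>)) * (z - 0) ^ n"
      by (simp only: integral_mult_left_zero diff_0_right)
  qed
  finally show "(\<lambda>n. (LINT \<xi>|circle_measure. b n * cnj \<xi> ^ n * complex_of_real (W \<xi>)) * (z - 0) ^ n) sums Herglotz W z" .
qed

text \<open>Near \<open>\<xi>\<close> uniform continuity of \<open>v\<close> is used, away from
  \<open>\<xi>\<close> the kernel is uniformly small. Uniformity in \<open>\<xi>\<close> matters:
  the maximum principle later needs the error to be small on the whole circle at a single
  radius.\<close>

lemma Poisson_approximate_identity:
  fixes v :: "complex \<Rightarrow> real"
  assumes v: "continuous_on (sphere 0 1) v" and e: "0 < e"
  shows "\<forall>\<^sub>F s in at_left 1. \<forall>\<xi>\<in>sphere 0 1.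
           \<bar>(LINT \<eta>|circle_measure. Poisson (complex_of_real s * \<xi>) \<eta> * v \<eta>) - v \<xi>\<bar> \<le> e"
proof -
  have "compact (v ` sphere 0 1)"
    by (rule compact_continuous_image[OF v]) simp
  then obtain M where M: "\<And>\<xi>. \<xi> \<in> sphere 0 1 \<Longrightarrow> \<bar>v \<xi>\<bar> \<le> M"
    using compact_imp_bounded[of "v ` sphere 0 1"] unfolding bounded_iff by (metis image_eqI real_norm_def)
  have M0: "0 \<le> M" using M[of 1] by simp
  have "uniformly_continuous_on (sphere 0 1) v"
    by (rule compact_uniformly_continuous[OF v]) simp
  then obtain d where d: "0 < d"
    and vd: "\<And>\<xi> \<eta>. \<lbrakk>\<xi> \<in> sphere 0 1; \<eta> \<in> sphere 0 1; dist \<eta> \<xi> < d\<rbrakk> \<Longrightarrow> dist (v \<eta>) (v \<xi>) < e / 2"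
    using e unfolding uniformly_continuous_on_def by (meson half_gt_zero)
  \<comment> \<open>The bound \<open>d / 2\<close> keeps points at distance at least
    \<open>d\<close> from \<open>\<xi>\<close> at distance at least \<open>d / 2\<close> from
    \<open>z\<close>. The second bound is solved from \<open>K \<le> e / 2\<close>, with
    \<open>M + 1\<close> guarding against division by zero.\<close>
  define D where "D = min (d / 2) (e * d\<^sup>2 / (32 * (M + 1)))"
  have D: "0 < D" using d e M0 by (simp add: D_def)
  have main: "\<bar>(LINT \<eta>|circle_measure. Poisson (complex_of_real s * \<xi>) \<eta> * v \<eta>) - v \<xi>\<bar> \<le> e"
    if s: "0 < s" "1 - D < s" "s < 1" and \<xi>: "norm \<xi> = 1" for s \<xi>
  proof -
    define z where "z = complex_of_real s * \<xi>"
    have z: "norm z = s" using s \<xi> by (simp add: z_def norm_mult)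
    then have z1: "norm z < 1" using s by simp
    define K where "K = 2 * M * (8 * (1 - s) / d\<^sup>2)"
    have pt: "\<bar>Poisson z \<eta> * (v \<eta> - v \<xi>)\<bar> \<le> Poisson z \<eta> * (e / 2) + K" if "\<eta> \<in> space circle_measure" for \<eta>
    proof (cases "dist \<eta> \<xi> < d")
      case True
      then have "\<bar>v \<eta> - v \<xi>\<bar> \<le> e / 2" using vd[of \<xi> \<eta>] that \<xi> by (simp add: dist_real_def)
      then have "\<bar>Poisson z \<eta> * (v \<eta> - v \<xi>)\<bar> \<le> Poisson z \<eta> * (e / 2)"
        unfolding abs_mult abs_of_nonneg[OF Poisson_nonneg[OF z1]]
        by (intro mult_left_mono Poisson_nonneg z1)
      moreover have "0 \<le> K" using s d M0 by (simp add: K_def)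
      ultimately show ?thesis by simp
    next
      case False
      have "norm (\<xi> - z) = 1 - s"
      proof -
        have "\<xi> - z = complex_of_real (1 - s) * \<xi>" by (simp add: z_def algebra_simps)
        then show ?thesis using \<xi> s by (simp only: norm_mult norm_of_real) simp
      qed
      moreover have "norm (\<eta> - \<xi>) \<le> norm (\<eta> - z) + norm (\<xi> - z)"
        using norm_triangle_ineq4[of "\<eta> - z" "\<xi> - z"] by simp
      ultimately have "d / 2 \<le> norm (\<eta> - z)"
        using False s by (simp add: dist_norm D_def)
      then have "(d / 2)\<^sup>2 \<le> (norm (\<eta> - z))\<^sup>2" using d by (intro power_mono) auto
      then have "Poisson z \<eta> \<le> (1 - s\<^sup>2) / (d / 2)\<^sup>2"
        unfolding Poisson_def z using d s
        by (intro divide_left_mono mult_pos_pos) (auto simp: power_le_one intro: less_le_trans[of 0 "(d/2)\<^sup>2"])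
      also have "\<dots> \<le> 2 * (1 - s) / (d / 2)\<^sup>2"
      proof (rule divide_right_mono)
        have "1 - s\<^sup>2 = (1 - s) * (1 + s)" by (simp add: power2_eq_square algebra_simps)
        also have "\<dots> \<le> (1 - s) * 2" using s by (intro mult_left_mono) auto
        finally show "1 - s\<^sup>2 \<le> 2 * (1 - s)" by simp
      qed simp
      finally have P: "Poisson z \<eta> \<le> 8 * (1 - s) / d\<^sup>2" by (simp add: power_divide)
      have "\<bar>v \<eta> - v \<xi>\<bar> \<le> 2 * M" using M[of \<eta>] M[of \<xi>] that \<xi> by simp
      then have "\<bar>Poisson z \<eta> * (v \<eta> - v \<xi>)\<bar> \<le> 8 * (1 - s) / d\<^sup>2 * (2 * M)"
        unfolding abs_mult using P Poisson_nonneg[OF z1, of \<eta>] by (intro mult_mono) auto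
      moreover have "0 \<le> Poisson z \<eta> * (e / 2)" using Poisson_nonneg[OF z1] e by simp
      ultimately show ?thesis by (simp add: K_def mult_ac)
    qed
    have Pc: "continuous_on (sphere 0 1) (Poisson z)" by (rule continuous_on_Poisson[OF z1])
    have i1: "integrable circle_measure (\<lambda>\<eta>. Poisson z \<eta> * v \<eta>)"
      and i2: "integrable circle_measure (Poisson z)"
      and i3: "integrable circle_measure (\<lambda>\<eta>. Poisson z \<eta> * (v \<eta> - v \<xi>))"
      by (intro integrable_circle_continuous continuous_intros Pc v)+
    have "(LINT \<eta>|circle_measure. Poisson z \<eta> * v \<eta>) - v \<xi> = (LINT \<eta>|circle_measure. Poisson z \<eta> * (v \<eta> - v \<xi>))"
    proof -
      have "(LINT \<eta>|circle_measure. Poisson z \<eta> * (v \<eta> - v \<xi>)) = (LINT \<eta>|circle_measure. Poisson z \<eta> * v \<eta> - Poisson z \<eta> * v \<xi>)"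
        by (simp add: algebra_simps)
      also have "\<dots> = (LINT \<eta>|circle_measure. Poisson z \<eta> * v \<eta>) - (LINT \<eta>|circle_measure. Poisson z \<eta> * v \<xi>)"
        by (rule Bochner_Integration.integral_diff[OF i1]) (use i2 in simp)
      also have "(LINT \<eta>|circle_measure. Poisson z \<eta> * v \<xi>) = v \<xi>"
        by (simp add: integral_Poisson[OF z1])
      finally show ?thesis by simp
    qed
    also have "\<bar>\<dots>\<bar> \<le> (LINT \<eta>|circle_measure. Poisson z \<eta> * (e / 2) + K)"
      using integral_norm_bound[of circle_measure "\<lambda>\<eta>. Poisson z \<eta> * (v \<eta> - v \<xi>)"]
      by (rule order_trans[rotated, OF order_trans[OF _ integral_mono]])
        (use pt i2 i3 in auto)
    also have "\<dots> = e / 2 + K"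
      using i2 by (simp add: integral_Poisson[OF z1] measure_circle_space)
    also have "K \<le> e / 2"
    proof -
      have "1 - s \<le> e * d\<^sup>2 / (32 * (M + 1))" using s by (simp add: D_def)
      then have "(1 - s) * (32 * (M + 1)) \<le> e * d\<^sup>2" using M0 by (simp add: field_simps)
      moreover have "(1 - s) * (32 * M) \<le> (1 - s) * (32 * (M + 1))" using s by (intro mult_left_mono) auto
      ultimately have "(1 - s) * (32 * M) \<le> e * d\<^sup>2" by linarith
      then show ?thesis using d by (simp add: K_def field_simps)
    qed
    finally show ?thesis unfolding z_def by simp
  qed
  have "\<forall>\<^sub>F s in at_left 1. s \<in> {max 0 (1 - D)<..<1}"
    using D by (intro eventually_at_left_real) auto
  then show ?thesis
    by eventually_elim (use main in auto)
qed

text \<open>The floor \<open>e\<close> makes the boundary data \<open>v\<close> continuous, so an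
  analytic function with real part close to \<open>v\<close> on the circle is at hand and
  \<open>f\<close> can be divided by its exponential. The maximum principle bounds the quotient by
  \<open>exp \<epsilon>\<close>; then the radius tends to \<open>1\<close> and
  \<open>\<epsilon>\<close> to \<open>0\<close>.\<close>

lemma norm_le_exp_Poisson_ln_max:
  assumes f: "continuous_on (cball 0 1) f" "f holomorphic_on ball 0 1" and e: "0 < e" and z: "norm z < 1"
  shows "norm (f z) \<le> exp (LINT \<xi>|circle_measure. Poisson z \<xi> * ln (max (norm (f \<xi>)) e))"
proof -
  define v where "v \<xi> = ln (max (norm (f \<xi>)) e)" for \<xi>
  have "continuous_on (sphere 0 1) f" by (rule continuous_on_subset[OF f(1)]) auto
  then have vc: "continuous_on (sphere 0 1) v"
    unfolding v_def using e by (intro continuous_intros) auto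
  then have vi: "integrable circle_measure v" by (rule integrable_circle_continuous)
  let ?h = "Herglotz v"
  have h: "?h holomorphic_on ball 0 1" by (rule holomorphic_Herglotz[OF vi])
  have step: "norm (f z) \<le> exp \<epsilon> * exp (Re (?h z))" if "0 < \<epsilon>" for \<epsilon>
  proof -
    have ev: "\<forall>\<^sub>F s in at_left 1. norm (f z) \<le> exp \<epsilon> * exp (Re (?h (complex_of_real s * z)))"
      using Poisson_approximate_identity[OF vc that] eventually_at_left_real[of 0 "1::real", simplified]
    proof eventually_elim
      case (elim s)
      then have s: "0 < s" "s < 1" by auto
      have sc: "norm (complex_of_real s * w) < 1" if "norm w \<le> 1" for w
        using s that by (auto simp: norm_mult intro: le_less_trans[OF mult_left_le])
      \<comment> \<open>The Herglotz integral is dilated by \<open>s < 1\<close> because continuity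
        up to the circle is available only for the dilate, while its real part is still within
        \<open>\<epsilon>\<close> of \<open>v\<close> there.\<close>
      define g where "g w = f w * exp (- ?h (complex_of_real s * w))" for w
      have hc: "continuous_on (cball 0 1) (\<lambda>w. ?h (complex_of_real s * w))"
        by (rule continuous_on_compose2[OF holomorphic_on_imp_continuous_on[OF h]])
           (use sc in \<open>auto intro!: continuous_intros\<close>)
      have hh: "(\<lambda>w. ?h (complex_of_real s * w)) holomorphic_on ball 0 1"
        by (rule holomorphic_on_compose_gen[OF _ h, unfolded o_def])
           (use sc in \<open>auto intro!: holomorphic_intros\<close>)
      have "norm (g z) \<le> exp \<epsilon>"
      proof (rule maximum_modulus_frontier[of g "ball 0 1"])
        show "g holomorphic_on interior (ball 0 1)"
          unfolding g_def by (simp, intro holomorphic_intros f hh)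
        show "continuous_on (closure (ball 0 1)) g"
          unfolding g_def by (simp, intro continuous_intros f hc)
        fix w :: complex assume "w \<in> frontier (ball 0 1)"
        then have w: "norm w = 1" by (simp add: frontier_ball)
        have "v w - Re (?h (complex_of_real s * w)) \<le> \<epsilon>"
          using elim(1) w Re_Herglotz[OF vi sc[of w]] by force
        have "norm (f w) \<le> exp (v w)"
          unfolding v_def using e by (subst exp_ln) auto
        then have "norm (g w) \<le> exp (v w) * exp (- Re (?h (complex_of_real s * w)))"
          unfolding g_def norm_mult by (intro mult_mono) auto
        also have "\<dots> = exp (v w - Re (?h (complex_of_real s * w)))" by (simp flip: exp_add)
        also have "\<dots> \<le> exp \<epsilon>" using \<open>v w - _ \<le> \<epsilon>\<close> by simp
        finally show "norm (g w) \<le> exp \<epsilon>" .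
      qed (use z in auto)
      then have "norm (f z) * exp (- Re (?h (complex_of_real s * z))) \<le> exp \<epsilon>"
        by (simp add: g_def norm_mult)
      then show ?case by (simp add: exp_minus field_simps)
    qed
    show ?thesis
    proof (rule tendsto_lowerbound[OF _ ev])
      have "isCont ?h z"
        using holomorphic_on_imp_continuous_on[OF h] z by (simp add: continuous_on_eq_continuous_at)
      moreover have "((\<lambda>s. complex_of_real s * z) \<longlongrightarrow> of_real 1 * z) (at_left 1)"
        by (intro tendsto_intros)
      ultimately have "((\<lambda>s. ?h (complex_of_real s * z)) \<longlongrightarrow> ?h z) (at_left 1)"
        using isCont_tendsto_compose by fastforce
      then show "((\<lambda>s. exp \<epsilon> * exp (Re (?h (complex_of_real s * z)))) \<longlongrightarrow> exp \<epsilon> * exp (Re (?h z))) (at_left 1)"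
        by (intro tendsto_intros)
    qed simp
  qed
  have "norm (f z) \<le> exp 0 * exp (Re (?h z))"
  proof (rule tendsto_lowerbound)
    show "((\<lambda>\<epsilon>. exp \<epsilon> * exp (Re (?h z))) \<longlongrightarrow> exp 0 * exp (Re (?h z))) (at_right 0)"
      by (intro tendsto_intros)
    show "\<forall>\<^sub>F \<epsilon> in at_right 0. norm (f z) \<le> exp \<epsilon> * exp (Re (?h z))"
      using eventually_at_right_less by eventually_elim (rule step)
  qed simp
  then show ?thesis by (simp add: Re_Herglotz[OF vi z] v_def)
qed

subsection \<open>Outer functions\<close>

lemma Herglotz_add:
  assumes "integrable circle_measure V" "integrable circle_measure W" "norm z < 1"
  shows "Herglotz (\<lambda>\<xi>. V \<xi> + W \<xi>) z = Herglotz V z + Herglotz W z"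
  unfolding Herglotz_def
  using Bochner_Integration.integral_add[OF integrable_Herglotz[OF assms(1,3)] integrable_Herglotz[OF assms(2,3)]]
  by (simp only: of_real_add distrib_left)

lemma Herglotz_minus: "Herglotz (\<lambda>\<xi>. - W \<xi>) z = - Herglotz W z"
  unfolding Herglotz_def by simp

lemma Herglotz_const: "norm z < 1 \<Longrightarrow> Herglotz (\<lambda>_. c) z = complex_of_real c"
  unfolding Herglotz_def by (simp only: integral_mult_left_zero integral_Herglotz_kernel) simp

lemma outer_functionI:
  assumes W: "integrable circle_measure W" and \<gamma>: "norm \<gamma> = 1"
    and f: "\<And>z. norm z < 1 \<Longrightarrow> f z = \<gamma> * exp (Herglotz W z)"
  shows "outer_function f"
  unfolding outer_function_def
proof (intro conjI exI[of _ \<gamma>] exI[of _ "\<lambda>\<xi>. ereal (W \<xi>)"])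
  have "(\<lambda>z. \<gamma> * exp (Herglotz W z)) holomorphic_on ball 0 1"
    by (intro holomorphic_intros holomorphic_Herglotz W)
  then show "f holomorphic_on ball 0 1"
    by (rule holomorphic_transform) (simp add: f)
  show "(\<integral>\<^sup>+\<xi>. e2ennreal \<bar>ereal (W \<xi>)\<bar> \<partial>circle_measure) < \<infinity>"
    using W by (simp add: integrable_iff_bounded)
qed (use \<gamma> f W in \<open>auto simp: Herglotz_def\<close>)

lemma outer_functionE:
  assumes "outer_function f"
  obtains \<gamma> W where "norm \<gamma> = 1" "integrable circle_measure W"
    "\<And>z. norm z < 1 \<Longrightarrow> f z = \<gamma> * exp (Herglotz W z)"
proof -
  obtain \<gamma> V where \<gamma>: "norm \<gamma> = 1" and V: "V \<in> borel_measurable circle_measure"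
    and fin: "(\<integral>\<^sup>+\<xi>. e2ennreal \<bar>V \<xi>\<bar> \<partial>circle_measure) < \<infinity>"
    and f: "\<forall>z\<in>ball 0 1. f z = \<gamma> * exp (LINT \<xi>|circle_measure. (\<xi> + z) / (\<xi> - z) * complex_of_real (real_of_ereal (V \<xi>)))"
    using assms unfolding outer_function_def by blast
  have "integrable circle_measure (\<lambda>\<xi>. real_of_ereal (V \<xi>))"
  proof (rule integrableI_bounded)
    show "(\<lambda>\<xi>. real_of_ereal (V \<xi>)) \<in> borel_measurable circle_measure"
      using V by measurable
    have "ennreal (norm (real_of_ereal x)) \<le> e2ennreal \<bar>x\<bar>" for x
      by (cases x) auto
    then have "(\<integral>\<^sup>+\<xi>. ennreal (norm (real_of_ereal (V \<xi>))) \<partial>circle_measure) \<le> (\<integral>\<^sup>+\<xi>. e2ennreal \<bar>V \<xi>\<bar> \<partial>circle_measure)"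
      by (intro nn_integral_mono)
    then show "(\<integral>\<^sup>+\<xi>. ennreal (norm (real_of_ereal (V \<xi>))) \<partial>circle_measure) < \<infinity>"
      using fin by (rule le_less_trans)
  qed
  then show thesis
    using that[OF \<gamma>, of "\<lambda>\<xi>. real_of_ereal (V \<xi>)"] f by (simp add: Herglotz_def)
qed

text \<open>A quotient corresponds to a difference of weights. A positive constant does not fit into
  the unimodular factor; it enters the weight as \<open>ln c\<close>, since the Herglotz integral of
  a constant is that constant.\<close>

lemma outer_function_cmult_divide:
  assumes "outer_function f" "outer_function g" and c: "0 < c"
  shows "outer_function (\<lambda>z. complex_of_real c * f z / g z)"
proof -
  obtain \<alpha> V where f: "norm \<alpha> = 1" "integrable circle_measure V"
    "\<And>z. norm z < 1 \<Longrightarrow> f z = \<alpha> * exp (Herglotz V z)"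
    using outer_functionE[OF assms(1)] by metis
  obtain \<beta> W where g: "norm \<beta> = 1" "integrable circle_measure W"
    "\<And>z. norm z < 1 \<Longrightarrow> g z = \<beta> * exp (Herglotz W z)"
    using outer_functionE[OF assms(2)] by metis
  show ?thesis
  proof (rule outer_functionI[of "\<lambda>\<xi>. V \<xi> + (- W \<xi> + ln c)" "\<alpha> / \<beta>"])
    fix z :: complex assume z: "norm z < 1"
    have "Herglotz (\<lambda>\<xi>. V \<xi> + (- W \<xi> + ln c)) z = Herglotz V z + (- Herglotz W z + complex_of_real (ln c))"
      using f(2) g(2) z by (simp add: Herglotz_add Herglotz_minus Herglotz_const del: uminus_add_conv_diff)
    moreover have "exp (complex_of_real (ln c)) = complex_of_real c"
      using c by (simp add: exp_of_real)
    ultimately show "complex_of_real c * f z / g z = \<alpha> / \<beta> * exp (Herglotz (\<lambda>\<xi>. V \<xi> + (- W \<xi> + ln c)) z)"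
      using z by (simp add: f(3) g(3) exp_add exp_diff exp_minus divide_inverse)
  qed (use f g in \<open>auto simp: norm_divide\<close>)
qed

lemma norm_exp_Herglotz:
  "integrable circle_measure W \<Longrightarrow> norm z < 1 \<Longrightarrow>
    norm (exp (Herglotz W z)) = exp (LINT \<xi>|circle_measure. Poisson z \<xi> * W \<xi>)"
  by (simp add: Re_Herglotz)

text \<open>Writing \<open>\<bar>W\<bar> = min \<bar>W\<bar> k + R\<close>, the bounded part contributes at most \<open>(1 - \<bar>z\<bar>) * k\<close>,
  and \<open>R\<close> at most twice its integral because \<open>(1 - \<bar>z\<bar>) * Poisson z \<xi> \<le> 2\<close>.\<close>

lemma Poisson_integral_growth:
  assumes W: "integrable circle_measure W" and z: "\<And>n. norm (z n) < 1" "(\<lambda>n. norm (z n)) \<longlonglongrightarrow> 1"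
  shows "(\<lambda>n. (1 - norm (z n)) * (LINT \<xi>|circle_measure. Poisson (z n) \<xi> * W \<xi>)) \<longlonglongrightarrow> 0"
proof (rule LIMSEQ_I)
  fix e :: real assume e: "0 < e"
  define m where "m k \<xi> = min \<bar>W \<xi>\<bar> (real k)" for k \<xi>
  have [measurable]: "W \<in> borel_measurable circle_measure" using W by auto
  have mi: "integrable circle_measure (m k)" for k
    unfolding m_def
    by (rule Bochner_Integration.integrable_bound[OF integrable_norm[OF W]]) auto
  have "(\<lambda>k. LINT \<xi>|circle_measure. m k \<xi>) \<longlonglongrightarrow> (LINT \<xi>|circle_measure. \<bar>W \<xi>\<bar>)"
  proof (rule integral_dominated_convergence[where w = "\<lambda>\<xi>. \<bar>W \<xi>\<bar>"])
    show "AE \<xi> in circle_measure. (\<lambda>k. m k \<xi>) \<longlonglongrightarrow> \<bar>W \<xi>\<bar>"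
    proof (rule AE_I2)
      fix \<xi>
      have "\<forall>\<^sub>F k in sequentially. \<bar>W \<xi>\<bar> \<le> real k"
        using filterlim_real_sequentially by (simp add: filterlim_at_top)
      then have "\<forall>\<^sub>F k in sequentially. m k \<xi> = \<bar>W \<xi>\<bar>"
        by eventually_elim (simp add: m_def)
      then show "(\<lambda>k. m k \<xi>) \<longlonglongrightarrow> \<bar>W \<xi>\<bar>" by (rule tendsto_eventually)
    qed
  qed (use W in \<open>auto simp: m_def\<close>)
  then obtain k where k: "\<bar>(LINT \<xi>|circle_measure. m k \<xi>) - (LINT \<xi>|circle_measure. \<bar>W \<xi>\<bar>)\<bar> < e / 4"
    using LIMSEQ_D[of _ _ "e / 4"] e by (metis order_refl real_norm_def zero_less_divide_iff zero_less_numeral)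
  have bound: "\<bar>(1 - norm (z n)) * (LINT \<xi>|circle_measure. Poisson (z n) \<xi> * W \<xi>)\<bar> \<le> (1 - norm (z n)) * real k + e / 2" for n
  proof -
    have pi: "integrable circle_measure (\<lambda>\<xi>. Poisson (z n) \<xi> * \<bar>W \<xi>\<bar>)"
      and pm: "integrable circle_measure (Poisson (z n))"
      using integrable_Poisson[OF _ z(1)] W integrable_circle_continuous[OF continuous_on_Poisson[OF z(1)]] by auto
    have "\<bar>LINT \<xi>|circle_measure. Poisson (z n) \<xi> * W \<xi>\<bar> \<le> (LINT \<xi>|circle_measure. Poisson (z n) \<xi> * \<bar>W \<xi>\<bar>)"
      using integral_norm_bound[of circle_measure "\<lambda>\<xi>. Poisson (z n) \<xi> * W \<xi>"]
      by (simp add: abs_mult Poisson_nonneg[OF z(1)])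
    then have "(1 - norm (z n)) * \<bar>LINT \<xi>|circle_measure. Poisson (z n) \<xi> * W \<xi>\<bar> \<le>
        (1 - norm (z n)) * (LINT \<xi>|circle_measure. Poisson (z n) \<xi> * \<bar>W \<xi>\<bar>)"
      using z(1)[of n] by (intro mult_left_mono) auto
    also have "\<dots> = (LINT \<xi>|circle_measure. (1 - norm (z n)) * (Poisson (z n) \<xi> * \<bar>W \<xi>\<bar>))"
      by simp
    also have "\<dots> \<le> (LINT \<xi>|circle_measure. (1 - norm (z n)) * real k * Poisson (z n) \<xi> + 2 * (\<bar>W \<xi>\<bar> - m k \<xi>))"
    proof (rule integral_mono)
      fix \<xi> assume "\<xi> \<in> space circle_measure"
      then have "norm \<xi> = 1" by simp
      then have "Poisson (z n) \<xi> \<le> 2 / (1 - norm (z n))" by (rule Poisson_le[OF z(1)])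
      then have P2: "(1 - norm (z n)) * Poisson (z n) \<xi> \<le> 2" using z(1)[of n] by (simp add: field_simps)
      have P0: "0 \<le> (1 - norm (z n)) * Poisson (z n) \<xi>" using z(1)[of n] Poisson_nonneg[OF z(1)] by simp
      have "(1 - norm (z n)) * Poisson (z n) \<xi> * m k \<xi> \<le> (1 - norm (z n)) * Poisson (z n) \<xi> * real k"
        by (rule mult_left_mono[OF _ P0]) (simp add: m_def)
      moreover have "(1 - norm (z n)) * Poisson (z n) \<xi> * (\<bar>W \<xi>\<bar> - m k \<xi>) \<le> 2 * (\<bar>W \<xi>\<bar> - m k \<xi>)"
        by (rule mult_right_mono[OF P2]) (simp add: m_def)
      ultimately show "(1 - norm (z n)) * (Poisson (z n) \<xi> * \<bar>W \<xi>\<bar>) \<le> (1 - norm (z n)) * real k * Poisson (z n) \<xi> + 2 * (\<bar>W \<xi>\<bar> - m k \<xi>)"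
        by (simp add: algebra_simps)
    qed (use pi pm mi W in auto)
    also have "\<dots> = (1 - norm (z n)) * real k + 2 * ((LINT \<xi>|circle_measure. \<bar>W \<xi>\<bar>) - (LINT \<xi>|circle_measure. m k \<xi>))"
      using pm mi W z(1)[of n] by (simp add: integral_Poisson)
    also have "\<dots> \<le> (1 - norm (z n)) * real k + e / 2"
      using le_less_trans[OF abs_ge_minus_self k] by (intro add_left_mono) simp
    finally show ?thesis using z(1)[of n] by (simp add: abs_mult)
  qed
  have "(\<lambda>n. (1 - norm (z n)) * real k + e / 2) \<longlonglongrightarrow> (1 - 1) * real k + e / 2"
    by (intro tendsto_intros z(2))
  then have "\<forall>\<^sub>F n in sequentially. (1 - norm (z n)) * real k + e / 2 < e"
    by (rule order_tendstoD(2)) (use e in auto)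
  then show "\<exists>no. \<forall>n\<ge>no. norm ((1 - norm (z n)) * (LINT \<xi>|circle_measure. Poisson (z n) \<xi> * W \<xi>) - 0) < e"
    unfolding eventually_sequentially using bound by (auto intro: le_less_trans)
qed

subsection \<open>Boundary values\<close>

text \<open>A fixed sequence of radii makes boundary functions limits of countably many measurable
  functions and fits dominated convergence. The shift by \<open>2\<close> keeps every radius
  strictly positive.\<close>

definition radius_seq :: "nat \<Rightarrow> real" where
  "radius_seq k = 1 - 1 / real (k + 2)"

lemma radius_seq: "0 < radius_seq k" "radius_seq k < 1"
  by (auto simp: radius_seq_def)

lemma filterlim_radius_seq: "filterlim radius_seq (at_left 1) sequentially"
  unfolding filterlim_at
proof
  have "(\<lambda>k. 1 - 1 / real (k + 2)) \<longlonglongrightarrow> 1 - 0"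
    by (intro tendsto_intros LIMSEQ_ignore_initial_segment[of "\<lambda>n. 1 / real n"] lim_1_over_n)
  then show "radius_seq \<longlonglongrightarrow> 1" by (simp add: radius_seq_def[abs_def])
  have "radius_seq k \<in> {..<1} \<and> radius_seq k \<noteq> 1" for k using radius_seq(2)[of k] by auto
  then show "\<forall>\<^sub>F k in sequentially. radius_seq k \<in> {..<1} \<and> radius_seq k \<noteq> 1"
    by (intro always_eventually allI)
qed

text \<open>Total by means of \<open>lim\<close>: where the sequence diverges the value is
  arbitrary, yet the function is still measurable. For bounded analytic \<open>f\<close> it is
  almost everywhere the true radial limit.\<close>

definition radial_limit :: "(complex \<Rightarrow> complex) \<Rightarrow> complex \<Rightarrow> complex" where
  "radial_limit f \<xi> = lim (\<lambda>k. f (complex_of_real (radius_seq k) * \<xi>))"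

lemma continuous_on_circle_dilate:
  assumes f: "f holomorphic_on ball 0 1" and r: "0 \<le> r" "r < 1"
  shows "continuous_on (cball 0 1) (\<lambda>\<xi>. f (complex_of_real r * \<xi>))"
    and "(\<lambda>\<xi>. f (complex_of_real r * \<xi>)) holomorphic_on ball 0 1"
proof -
  have sc: "norm (complex_of_real r * w) < 1" if "norm w \<le> 1" for w
    using r that by (auto simp: norm_mult intro: le_less_trans[OF mult_left_le])
  show "continuous_on (cball 0 1) (\<lambda>\<xi>. f (complex_of_real r * \<xi>))"
    by (rule continuous_on_compose2[OF holomorphic_on_imp_continuous_on[OF f]])
       (use sc in \<open>auto intro!: continuous_intros\<close>)
  show "(\<lambda>\<xi>. f (complex_of_real r * \<xi>)) holomorphic_on ball 0 1"
    by (rule holomorphic_on_compose_gen[OF _ f, unfolded o_def])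
       (use sc in \<open>auto intro!: holomorphic_intros\<close>)
qed

lemma radial_limit_eqI:
  assumes "((\<lambda>r. f (complex_of_real r * \<xi>)) \<longlongrightarrow> l) (at_left 1)"
  shows "radial_limit f \<xi> = l"
  unfolding radial_limit_def
  using filterlim_compose[OF assms filterlim_radius_seq] by (intro limI)

lemma measurable_radial_limit [measurable]:
  assumes f: "f holomorphic_on ball 0 1"
  shows "radial_limit f \<in> borel_measurable circle_measure"
  unfolding radial_limit_def
proof (rule borel_measurable_lim_metric)
  fix k
  have "continuous_on (sphere 0 1) (\<lambda>\<xi>. f (complex_of_real (radius_seq k) * \<xi>))"
    by (rule continuous_on_subset[OF continuous_on_circle_dilate(1)[OF f]]) (use radius_seq[of k] in auto)
  then show "(\<lambda>\<xi>. f (complex_of_real (radius_seq k) * \<xi>)) \<in> borel_measurable circle_measure"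
    by (rule borel_measurable_circle_continuous)
qed

lemma AE_radial_limit:
  assumes "bounded_analytic f"
  shows "AE \<xi> in circle_measure. ((\<lambda>r. f (complex_of_real r * \<xi>)) \<longlongrightarrow> radial_limit f \<xi>) (at_left 1)"
  using Fatou_radial_limit[OF assms] by eventually_elim (use radial_limit_eqI in blast)

lemma AE_radial_limit_seq:
  assumes "bounded_analytic f"
  shows "AE \<xi> in circle_measure. (\<lambda>k. f (complex_of_real (radius_seq k) * \<xi>)) \<longlonglongrightarrow> radial_limit f \<xi>"
  using AE_radial_limit[OF assms] by eventually_elim (rule filterlim_compose[OF _ filterlim_radius_seq])

lemma AE_radial_limit_rel:
  assumes f: "bounded_analytic f" and g: "bounded_analytic g"
    and le: "\<And>z. norm z < 1 \<Longrightarrow> norm (f z) \<le> norm (g z)"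
  shows "AE \<xi> in circle_measure. norm (radial_limit f \<xi>) \<le> norm (radial_limit g \<xi>)"
  using AE_radial_limit_seq[OF f] AE_radial_limit_seq[OF g] AE_space
proof eventually_elim
  case (elim \<xi>)
  show ?case
  proof (rule LIMSEQ_le[OF tendsto_norm[OF elim(1)] tendsto_norm[OF elim(2)]])
    show "\<exists>N. \<forall>n\<ge>N. norm (f (complex_of_real (radius_seq n) * \<xi>)) \<le> norm (g (complex_of_real (radius_seq n) * \<xi>))"
      using elim(3) radius_seq by (intro exI allI impI le) (simp add: norm_mult less_imp_le)
  qed
qed

text \<open>The closed disk estimate applies to the dilates of \<open>f\<close>. Since
  \<open>norm (f z) \<le> 1\<close> and \<open>e \<le> 1\<close>, all logarithms lie between
  \<open>ln e\<close> and \<open>0\<close>, which gives the dominating function as the radii tend to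
  \<open>1\<close>.\<close>

lemma norm_le_exp_Poisson_ln_max_radial_limit:
  assumes hol: "f holomorphic_on ball 0 1" and le1: "\<And>z. norm z < 1 \<Longrightarrow> norm (f z) \<le> 1"
    and e: "0 < e" "e \<le> 1" and z: "norm z < 1"
  shows "norm (f z) \<le> exp (LINT \<xi>|circle_measure. Poisson z \<xi> * ln (max (norm (radial_limit f \<xi>)) e))"
proof -
  have bf: "bounded_analytic f"
    unfolding bounded_analytic_def bounded_iff using hol le1 by (intro conjI exI[of _ 1]) auto
  have [measurable]: "radial_limit f \<in> borel_measurable circle_measure"
    by (rule measurable_radial_limit[OF hol])
  let ?f = "\<lambda>k \<xi>. f (complex_of_real (radius_seq k) * \<xi>)"
  have fc: "continuous_on (cball 0 1) (?f k)" "?f k holomorphic_on ball 0 1" for k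
    using continuous_on_circle_dilate[OF hol] radius_seq less_imp_le by blast+
  have [measurable]: "?f k \<in> borel_measurable circle_measure" for k
    by (rule borel_measurable_circle_continuous[OF continuous_on_subset[OF fc(1)]]) auto
  have [measurable]: "Poisson z \<in> borel_measurable circle_measure"
    by (rule borel_measurable_circle_continuous[OF continuous_on_Poisson[OF z]])
  have "(\<lambda>k. LINT \<xi>|circle_measure. Poisson z \<xi> * ln (max (norm (?f k \<xi>)) e)) \<longlonglongrightarrow>
     (LINT \<xi>|circle_measure. Poisson z \<xi> * ln (max (norm (radial_limit f \<xi>)) e))"
  proof (rule integral_dominated_convergence[where w = "\<lambda>\<xi>. Poisson z \<xi> * (- ln e)"])
    show "integrable circle_measure (\<lambda>\<xi>. Poisson z \<xi> * (- ln e))"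
      by (intro integrable_mult_left integrable_circle_continuous continuous_on_Poisson z)
    show "AE \<xi> in circle_measure. (\<lambda>k. Poisson z \<xi> * ln (max (norm (?f k \<xi>)) e)) \<longlonglongrightarrow>
        Poisson z \<xi> * ln (max (norm (radial_limit f \<xi>)) e)"
      using AE_radial_limit_seq[OF bf]
      by eventually_elim (intro tendsto_intros, use e in auto)
    show "AE \<xi> in circle_measure. norm (Poisson z \<xi> * ln (max (norm (?f k \<xi>)) e)) \<le> Poisson z \<xi> * (- ln e)" for k
    proof (rule AE_I2)
      fix \<xi> assume "\<xi> \<in> space circle_measure"
      then have "norm (?f k \<xi>) \<le> 1" using radius_seq[of k] by (intro le1) (simp add: norm_mult)
      then have "ln e \<le> ln (max (norm (?f k \<xi>)) e)" "ln (max (norm (?f k \<xi>)) e) \<le> 0"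
        using e by (simp_all add: less_max_iff_disj)
      then show "norm (Poisson z \<xi> * ln (max (norm (?f k \<xi>)) e)) \<le> Poisson z \<xi> * (- ln e)"
        using Poisson_nonneg[OF z, of \<xi>] unfolding norm_mult by (intro mult_mono) auto
    qed
  qed measurable
  then have R: "(\<lambda>k. exp (LINT \<xi>|circle_measure. Poisson z \<xi> * ln (max (norm (?f k \<xi>)) e))) \<longlonglongrightarrow>
     exp (LINT \<xi>|circle_measure. Poisson z \<xi> * ln (max (norm (radial_limit f \<xi>)) e))"
    by (rule tendsto_exp)
  have "((\<lambda>r. f (complex_of_real r * z)) \<longlongrightarrow> f z) (at_left 1)"
  proof -
    have "isCont f z"
      using holomorphic_on_imp_continuous_on[OF hol] z by (simp add: continuous_on_eq_continuous_at)
    moreover have "((\<lambda>s. complex_of_real s * z) \<longlongrightarrow> of_real 1 * z) (at_left 1)"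
      by (intro tendsto_intros)
    ultimately show ?thesis using isCont_tendsto_compose by fastforce
  qed
  then have L: "(\<lambda>k. norm (?f k z)) \<longlonglongrightarrow> norm (f z)"
    by (intro tendsto_norm filterlim_compose[OF _ filterlim_radius_seq])
  show ?thesis
    by (rule LIMSEQ_le[OF L R]) (use norm_le_exp_Poisson_ln_max[OF fc e(1) z] in blast)
qed

text \<open>The circle means of \<open>ln \<bar>exp (Herglotz V)\<bar>\<close> are all equal to the integral of \<open>V\<close>; for bounded
  \<open>V\<close> this survives the passage to the boundary.\<close>

lemma integral_ln_radial_limit_exp_Herglotz:
  assumes V: "integrable circle_measure V" and B: "AE \<xi> in circle_measure. \<bar>V \<xi>\<bar> \<le> B"
  shows "bounded_analytic (\<lambda>z. exp (Herglotz V z))"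
    and "AE \<xi> in circle_measure. \<bar>ln (norm (radial_limit (\<lambda>z. exp (Herglotz V z)) \<xi>))\<bar> \<le> B"
    and "AE \<xi> in circle_measure. radial_limit (\<lambda>z. exp (Herglotz V z)) \<xi> \<noteq> 0"
    and "(LINT \<xi>|circle_measure. ln (norm (radial_limit (\<lambda>z. exp (Herglotz V z)) \<xi>))) = (LINT \<xi>|circle_measure. V \<xi>)"
proof -
  let ?O = "\<lambda>z. exp (Herglotz V z)"
  have hh: "Herglotz V holomorphic_on ball 0 1" by (rule holomorphic_Herglotz[OF V])
  have hol: "?O holomorphic_on ball 0 1" by (intro holomorphic_intros hh)
  have ReB: "\<bar>Re (Herglotz V z)\<bar> \<le> B" if z: "norm z < 1" for z
  proof -
    have "\<bar>Re (Herglotz V z)\<bar> \<le> (LINT \<xi>|circle_measure. \<bar>Poisson z \<xi> * V \<xi>\<bar>)"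
      using integral_norm_bound[of circle_measure "\<lambda>\<xi>. Poisson z \<xi> * V \<xi>"] by (simp add: Re_Herglotz[OF V z])
    also have "\<dots> \<le> (LINT \<xi>|circle_measure. Poisson z \<xi> * B)"
    proof (rule integral_mono_AE)
      show "AE \<xi> in circle_measure. \<bar>Poisson z \<xi> * V \<xi>\<bar> \<le> Poisson z \<xi> * B"
        using B by eventually_elim (simp add: abs_mult Poisson_nonneg[OF z] mult_left_mono)
    qed (use integrable_Poisson[OF V z] integrable_circle_continuous[OF continuous_on_Poisson[OF z]] in auto)
    also have "\<dots> = B" by (simp add: integral_Poisson[OF z])
    finally show ?thesis .
  qed
  have up: "norm (?O z) \<le> exp B" and lo: "exp (- B) \<le> norm (?O z)" if "norm z < 1" for z
    using ReB[OF that] by auto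
  show bd: "bounded_analytic ?O"
    unfolding bounded_analytic_def bounded_iff using hol up by (intro conjI exI[of _ "exp B"]) auto
  \<comment> \<open>The lower bound is what lets the logarithm pass to the radial limit: it keeps
    the boundary values away from \<open>0\<close>.\<close>
  have rl: "AE \<xi> in circle_measure. exp (- B) \<le> norm (radial_limit ?O \<xi>) \<and> norm (radial_limit ?O \<xi>) \<le> exp B"
    using AE_radial_limit_seq[OF bd] AE_space
  proof eventually_elim
    case (elim \<xi>)
    have n: "norm (complex_of_real (radius_seq k) * \<xi>) < 1" for k
      using elim(2) radius_seq[of k] by (simp add: norm_mult)
    show ?case
      using LIMSEQ_le_const[OF tendsto_norm[OF elim(1)], of "exp (- B)"]
        LIMSEQ_le_const2[OF tendsto_norm[OF elim(1)], of "exp B"] up[OF n] lo[OF n] by blast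
  qed
  show "AE \<xi> in circle_measure. radial_limit ?O \<xi> \<noteq> 0"
    using rl by eventually_elim (metis exp_gt_zero norm_zero not_less)
  show "AE \<xi> in circle_measure. \<bar>ln (norm (radial_limit ?O \<xi>))\<bar> \<le> B"
    using rl
  proof eventually_elim
    case (elim \<xi>)
    then have p: "0 < norm (radial_limit ?O \<xi>)" using exp_gt_zero[of "- B"] by linarith
    have "- B \<le> ln (norm (radial_limit ?O \<xi>))" using elim p by (simp add: ln_ge_iff)
    moreover have "ln (norm (radial_limit ?O \<xi>)) \<le> B" using elim p by (metis ln_exp ln_le_cancel_iff exp_gt_zero)
    ultimately show ?case by simp
  qed
  let ?h = "\<lambda>k \<xi>. Herglotz V (complex_of_real (radius_seq k) * \<xi>)"
  have hc: "continuous_on (cball 0 1) (?h k)" "?h k holomorphic_on ball 0 1" for k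
    using continuous_on_circle_dilate[OF hh] radius_seq less_imp_le by blast+
  have hc': "continuous_on (sphere 0 1) (?h k)" for k
    by (rule continuous_on_subset[OF hc(1)]) auto
  have mean: "(LINT \<xi>|circle_measure. Re (?h k \<xi>)) = (LINT \<xi>|circle_measure. V \<xi>)" for k
  proof -
    have "(LINT \<xi>|circle_measure. ?h k \<xi> * \<xi> / (\<xi> - 0)) = ?h k 0"
      by (rule Cauchy_integral_circle[OF hc]) simp
    also have "(LINT \<xi>|circle_measure. ?h k \<xi> * \<xi> / (\<xi> - 0)) = (LINT \<xi>|circle_measure. ?h k \<xi>)"
      by (intro Bochner_Integration.integral_cong) auto
    finally have "Re (LINT \<xi>|circle_measure. ?h k \<xi>) = Re (Herglotz V 0)" by simp
    moreover have "Re (LINT \<xi>|circle_measure. ?h k \<xi>) = (LINT \<xi>|circle_measure. Re (?h k \<xi>))"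
      by (rule integral_Re[OF integrable_circle_continuous[OF hc'], symmetric])
    moreover have "Re (Herglotz V 0) = (LINT \<xi>|circle_measure. V \<xi>)"
      unfolding Re_Herglotz[OF V norm_zero[THEN eq_refl, THEN le_less_trans, OF zero_less_one]]
      by (intro Bochner_Integration.integral_cong) (auto simp: Poisson_def)
    ultimately show ?thesis by simp
  qed
  have [measurable]: "radial_limit ?O \<in> borel_measurable circle_measure"
    by (rule measurable_radial_limit[OF hol])
  have "(\<lambda>k. LINT \<xi>|circle_measure. Re (?h k \<xi>)) \<longlonglongrightarrow> (LINT \<xi>|circle_measure. ln (norm (radial_limit ?O \<xi>)))"
  proof (rule integral_dominated_convergence[where w = "\<lambda>_. B"])
    show "(\<lambda>\<xi>. Re (?h k \<xi>)) \<in> borel_measurable circle_measure" for k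
      by (intro borel_measurable_circle_continuous continuous_intros hc')
    show "AE \<xi> in circle_measure. norm (Re (?h k \<xi>)) \<le> B" for k
      using radius_seq[of k] by (intro AE_I2) (simp add: ReB norm_mult)
    show "AE \<xi> in circle_measure. (\<lambda>k. Re (?h k \<xi>)) \<longlonglongrightarrow> ln (norm (radial_limit ?O \<xi>))"
      using AE_radial_limit_seq[OF bd] \<open>AE \<xi> in circle_measure. radial_limit ?O \<xi> \<noteq> 0\<close>
    proof eventually_elim
      case (elim \<xi>)
      have "(\<lambda>k. ln (norm (?O (complex_of_real (radius_seq k) * \<xi>)))) \<longlonglongrightarrow> ln (norm (radial_limit ?O \<xi>))"
        using elim by (intro tendsto_intros) auto
      then show ?case by simp
    qed
  qed auto
  then show "(LINT \<xi>|circle_measure. ln (norm (radial_limit ?O \<xi>))) = (LINT \<xi>|circle_measure. V \<xi>)"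
    unfolding mean by (rule LIMSEQ_unique) simp
qed

subsection \<open>Inner-outer factorization\<close>

text \<open>The normalization by \<open>1\<close> makes the boundary logarithms nonpositive almost
  everywhere, so \<open>- V n\<close> increases to \<open>- W\<close> and monotone convergence
  applies. The single point \<open>z0\<close> supplies the bound on the integrals.\<close>

lemma inner_outer_factorization:
  assumes hol: "f holomorphic_on ball 0 1" and le1: "\<And>z. norm z < 1 \<Longrightarrow> norm (f z) \<le> 1"
    and z0: "norm z0 < 1" "f z0 \<noteq> 0"
  obtains I W where "inner_function I" "integrable circle_measure W"
    "\<And>z. norm z < 1 \<Longrightarrow> f z = I z * exp (Herglotz W z)"
proof -
  have bf: "bounded_analytic f"
    unfolding bounded_analytic_def bounded_iff using hol le1 by (intro conjI exI[of _ 1]) auto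
  define F where "F = radial_limit f"
  have [measurable]: "F \<in> borel_measurable circle_measure"
    unfolding F_def by (rule measurable_radial_limit[OF hol])
  have F1: "AE \<xi> in circle_measure. norm (F \<xi>) \<le> 1"
    using AE_radial_limit_seq[OF bf] AE_space
  proof eventually_elim
    case (elim \<xi>)
    have "norm (f (complex_of_real (radius_seq k) * \<xi>)) \<le> 1" for k
      using elim(2) radius_seq[of k] by (intro le1) (simp add: norm_mult)
    then show ?case
      unfolding F_def by (intro LIMSEQ_le_const2[OF tendsto_norm[OF elim(1)]]) auto
  qed
  define V where "V n \<xi> = ln (max (norm (F \<xi>)) (exp (- real n)))" for n \<xi>
  have [measurable]: "V n \<in> borel_measurable circle_measure" for n
    unfolding V_def by measurable
  have Vlow: "- real n \<le> V n \<xi>" for n \<xi>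
    unfolding V_def by (subst ln_ge_iff) (auto simp: less_max_iff_disj)
  have Vup: "AE \<xi> in circle_measure. \<forall>n. V n \<xi> \<le> 0"
    using F1 by eventually_elim (auto simp: V_def less_max_iff_disj)
  have Vdec: "V n \<xi> \<le> V m \<xi>" if "m \<le> n" for m n \<xi>
    unfolding V_def using that by (subst ln_le_cancel_iff) (auto simp: less_max_iff_disj simp del: max.bounded_iff intro!: max.mono)
  have Vabs: "AE \<xi> in circle_measure. \<bar>V n \<xi>\<bar> \<le> real n" for n
    using Vup
  proof eventually_elim
    case (elim \<xi>)
    have "V n \<xi> \<le> 0" using elim by blast
    with Vlow[of n \<xi>] show ?case by simp
  qed
  have Vint: "integrable circle_measure (V n)" for n
    by (rule circle.integrable_const_bound[of _ "real n"]) (use Vabs in auto)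
  have fV: "norm (f z) \<le> exp (LINT \<xi>|circle_measure. Poisson z \<xi> * V n \<xi>)" if "norm z < 1" for z n
    unfolding V_def F_def by (rule norm_le_exp_Poisson_ln_max_radial_limit[OF hol le1 _ _ that]) auto

  \<comment> \<open>The Poisson integral of \<open>V n\<close> at \<open>z0\<close> is at least
    \<open>ln (norm (f z0))\<close>, and the kernel there is at least
    \<open>(1 - norm z0) / 4\<close>. This caps the integral of \<open>- V n\<close> uniformly in
    \<open>n\<close>.\<close>
  define C where "C = - ln (norm (f z0)) / ((1 - norm z0) / 4)"
  have VC: "(LINT \<xi>|circle_measure. - V n \<xi>) \<le> C" for n
  proof -
    have "(1 - norm z0) / 4 * (LINT \<xi>|circle_measure. - V n \<xi>) = (LINT \<xi>|circle_measure. (1 - norm z0) / 4 * (- V n \<xi>))"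
      by (rule integral_mult_right_zero[symmetric])
    also have "\<dots> \<le> (LINT \<xi>|circle_measure. - (Poisson z0 \<xi> * V n \<xi>))"
    proof (rule integral_mono_AE)
      show "AE \<xi> in circle_measure. (1 - norm z0) / 4 * (- V n \<xi>) \<le> - (Poisson z0 \<xi> * V n \<xi>)"
        using Vup AE_space
      proof eventually_elim
        case (elim \<xi>)
        have "(1 - norm z0) / 4 * (- V n \<xi>) \<le> Poisson z0 \<xi> * (- V n \<xi>)"
          by (rule mult_right_mono) (use elim Poisson_ge[OF z0(1)] in auto)
        then show ?case by simp
      qed
    qed (use Vint integrable_Poisson[OF Vint z0(1)] in \<open>auto simp del: mult_minus_right\<close>)
    also have "\<dots> = - (LINT \<xi>|circle_measure. Poisson z0 \<xi> * V n \<xi>)" by simp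
    also have "\<dots> \<le> - ln (norm (f z0))"
    proof -
      have "ln (norm (f z0)) \<le> ln (exp (LINT \<xi>|circle_measure. Poisson z0 \<xi> * V n \<xi>))"
        using z0(2) fV[OF z0(1)] by (subst ln_le_cancel_iff) auto
      then show ?thesis by simp
    qed
    finally have "(1 - norm z0) / 4 * (LINT \<xi>|circle_measure. - V n \<xi>) \<le> - ln (norm (f z0))" .
    then show ?thesis using z0(1) by (simp add: C_def field_simps)
  qed

  \<comment> \<open>Where \<open>F\<close> vanishes, \<open>- V n\<close> equals \<open>n\<close>,
    so the measure of the zero set is at most \<open>C / n\<close> for every positive
    \<open>n\<close>. This must precede the definition of \<open>W\<close>, since \<open>ln\<close>
    at \<open>0\<close> is only a default value and not minus infinity.\<close>
  have F0: "AE \<xi> in circle_measure. F \<xi> \<noteq> 0"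
  proof -
    define Z where "Z = {\<xi> \<in> space circle_measure. F \<xi> = 0}"
    have [measurable]: "Z \<in> sets circle_measure" unfolding Z_def by measurable
    have Zi: "integrable circle_measure (indicator Z :: complex \<Rightarrow> real)"
      by (rule integrable_real_indicator)
         (use \<open>Z \<in> sets circle_measure\<close> in \<open>simp_all add: circle.emeasure_eq_measure del: sets_circle_measure\<close>)
    have ZS: "Z \<inter> sphere 0 1 = Z" by (auto simp: Z_def)
    have Zn: "real n * measure circle_measure Z \<le> C" for n
    proof -
      have "real n * measure circle_measure Z = (LINT \<xi>|circle_measure. real n * indicator Z \<xi>)"
        by (simp add: ZS)
      also have "\<dots> \<le> (LINT \<xi>|circle_measure. - V n \<xi>)"
      proof (rule integral_mono_AE)
        show "AE \<xi> in circle_measure. real n * indicator Z \<xi> \<le> - V n \<xi>"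
          using Vup
        proof eventually_elim
          case (elim \<xi>)
          then have "V n \<xi> \<le> 0" by blast
          then show ?case by (cases "\<xi> \<in> Z") (auto simp: Z_def V_def max_def)
        qed
      qed (use Vint Zi in auto)
      also have "\<dots> \<le> C" by (rule VC)
      finally show ?thesis .
    qed
    have "measure circle_measure Z = 0"
    proof (rule ccontr)
      assume "measure circle_measure Z \<noteq> 0"
      then have "0 < measure circle_measure Z" by (simp add: zero_less_measure_iff)
      then obtain n :: nat where "C < real n * measure circle_measure Z"
        using reals_Archimedean3 by blast
      then show False using Zn[of n] by simp
    qed
    then have "Z \<in> null_sets circle_measure"
      using \<open>Z \<in> sets circle_measure\<close>
      by (simp add: null_sets_def circle.emeasure_eq_measure del: sets_circle_measure)
    then show ?thesis by (rule AE_I') (auto simp: Z_def)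
  qed

  define W where "W \<xi> = ln (norm (F \<xi>))" for \<xi>
  have [measurable]: "W \<in> borel_measurable circle_measure" unfolding W_def by measurable
  have Vlim: "AE \<xi> in circle_measure. (\<lambda>n. V n \<xi>) \<longlonglongrightarrow> W \<xi>"
    using F0
  proof eventually_elim
    case (elim \<xi>)
    have "\<forall>\<^sub>F n in sequentially. - ln (norm (F \<xi>)) \<le> real n"
      using filterlim_real_sequentially by (simp add: filterlim_at_top)
    then have "\<forall>\<^sub>F n in sequentially. V n \<xi> = W \<xi>"
    proof eventually_elim
      case (elim n)
      then have "exp (- real n) \<le> exp (ln (norm (F \<xi>)))" by (subst exp_le_cancel_iff) linarith
      then show ?case using \<open>F \<xi> \<noteq> 0\<close> by (simp add: V_def W_def max_def)
    qed
    then show ?case by (rule tendsto_eventually)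
  qed
  have W0: "AE \<xi> in circle_measure. W \<xi> \<le> 0"
    using F0 F1 by eventually_elim (simp add: W_def)
  have WV: "AE \<xi> in circle_measure. \<forall>n. W \<xi> \<le> V n \<xi>"
    using F0 by eventually_elim (auto simp: W_def V_def less_max_iff_disj)
  have Wint: "integrable circle_measure W"
  proof -
    have "incseq (\<lambda>n. LINT \<xi>|circle_measure. - V n \<xi>)"
      using Vint Vdec by (intro monoI integral_mono) auto
    then obtain x where x: "(\<lambda>n. LINT \<xi>|circle_measure. - V n \<xi>) \<longlonglongrightarrow> x"
      using incseq_convergent[of "\<lambda>n. LINT \<xi>|circle_measure. - V n \<xi>" C] VC by blast
    have "integrable circle_measure (\<lambda>\<xi>. - W \<xi>)"
    proof (rule integral_monotone_convergence_nonneg(1)[OF _ _ _ _ x])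
      show "AE \<xi> in circle_measure. mono (\<lambda>n. - V n \<xi>)"
        using Vdec by (intro AE_I2 monoI) simp
      show "AE \<xi> in circle_measure. 0 \<le> - V n \<xi>" for n
        using Vup by eventually_elim simp
      show "AE \<xi> in circle_measure. (\<lambda>n. - V n \<xi>) \<longlonglongrightarrow> - W \<xi>"
        using Vlim by eventually_elim (rule tendsto_minus)
    qed (use Vint in auto)
    then show ?thesis using Bochner_Integration.integrable_minus by fastforce
  qed
  define G where "G z = exp (Herglotz W z)" for z
  have Gnorm: "norm (G z) = exp (LINT \<xi>|circle_measure. Poisson z \<xi> * W \<xi>)" if "norm z < 1" for z
    unfolding G_def by (rule norm_exp_Herglotz[OF Wint that])
  have Ghol: "G holomorphic_on ball 0 1"
    unfolding G_def by (intro holomorphic_intros holomorphic_Herglotz Wint)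
  have G1: "norm (G z) \<le> 1" if z: "norm z < 1" for z
  proof -
    have "(LINT \<xi>|circle_measure. Poisson z \<xi> * W \<xi>) \<le> 0"
    proof -
      have "0 \<le> (LINT \<xi>|circle_measure. - (Poisson z \<xi> * W \<xi>))"
        by (rule integral_nonneg_AE)
          (use W0 in eventually_elim, simp add: Poisson_nonneg[OF z] mult_nonneg_nonpos)
      then show ?thesis by simp
    qed
    then show ?thesis by (simp add: Gnorm[OF z])
  qed
  have Gb: "bounded_analytic G"
    unfolding bounded_analytic_def bounded_iff using Ghol G1 by (intro conjI exI[of _ 1]) auto
  have fG: "norm (f z) \<le> norm (G z)" if z: "norm z < 1" for z
  proof -
    have "(\<lambda>n. LINT \<xi>|circle_measure. Poisson z \<xi> * V n \<xi>) \<longlonglongrightarrow> (LINT \<xi>|circle_measure. Poisson z \<xi> * W \<xi>)"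
    proof (rule integral_dominated_convergence[where w = "\<lambda>\<xi>. Poisson z \<xi> * \<bar>W \<xi>\<bar>"])
      show "AE \<xi> in circle_measure. (\<lambda>n. Poisson z \<xi> * V n \<xi>) \<longlonglongrightarrow> Poisson z \<xi> * W \<xi>"
        using Vlim by eventually_elim (intro tendsto_intros)
      show "AE \<xi> in circle_measure. norm (Poisson z \<xi> * V n \<xi>) \<le> Poisson z \<xi> * \<bar>W \<xi>\<bar>" for n
        using WV Vup
      proof eventually_elim
        case (elim \<xi>)
        have "W \<xi> \<le> V n \<xi>" "V n \<xi> \<le> 0" using elim by blast+
        then have "\<bar>V n \<xi>\<bar> \<le> \<bar>W \<xi>\<bar>" by simp
        then show ?case by (simp add: abs_mult Poisson_nonneg[OF z] mult_left_mono)
      qed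
    qed (use integrable_Poisson[OF _ z] Wint Vint in \<open>auto dest: borel_measurable_integrable\<close>)
    then have "norm (f z) \<le> exp (LINT \<xi>|circle_measure. Poisson z \<xi> * W \<xi>)"
      by (intro LIMSEQ_le_const[OF tendsto_exp]) (use fV[OF z] in auto)
    then show ?thesis by (simp add: Gnorm[OF z])
  qed

  define H where "H n z = exp (Herglotz (V n) z)" for n z
  have Hb: "bounded_analytic (H n)"
    and Hln: "AE \<xi> in circle_measure. \<bar>ln (norm (radial_limit (H n) \<xi>))\<bar> \<le> real n"
    and H0: "AE \<xi> in circle_measure. radial_limit (H n) \<xi> \<noteq> 0"
    and Hint: "(LINT \<xi>|circle_measure. ln (norm (radial_limit (H n) \<xi>))) = (LINT \<xi>|circle_measure. V n \<xi>)" for n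
    unfolding H_def[abs_def] using integral_ln_radial_limit_exp_Herglotz[OF Vint Vabs] by blast+
  have [measurable]: "radial_limit (H n) \<in> borel_measurable circle_measure" for n
    by (rule measurable_radial_limit) (use Hb in \<open>auto simp: bounded_analytic_def\<close>)
  have GH: "norm (G z) \<le> norm (H n z)" if z: "norm z < 1" for z n
  proof -
    have "(LINT \<xi>|circle_measure. Poisson z \<xi> * W \<xi>) \<le> (LINT \<xi>|circle_measure. Poisson z \<xi> * V n \<xi>)"
    proof (rule integral_mono_AE)
      show "AE \<xi> in circle_measure. Poisson z \<xi> * W \<xi> \<le> Poisson z \<xi> * V n \<xi>"
        using WV by eventually_elim (simp add: Poisson_nonneg[OF z] mult_left_mono)
    qed (use integrable_Poisson[OF _ z] Wint Vint in auto)
    then show ?thesis unfolding H_def Gnorm[OF z] norm_exp_Herglotz[OF Vint z] by simp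
  qed
  have Heq: "AE \<xi> in circle_measure. norm (radial_limit (H n) \<xi>) = max (norm (F \<xi>)) (exp (- real n))" for n
  proof -
    have lnint: "integrable circle_measure (\<lambda>\<xi>. ln (norm (radial_limit (H n) \<xi>)))"
      by (rule circle.integrable_const_bound[of _ "real n"]) (use Hln in auto)
    have fH: "AE \<xi> in circle_measure. norm (radial_limit f \<xi>) \<le> norm (radial_limit (H n) \<xi>)"
      by (rule AE_radial_limit_rel[OF bf Hb]) (meson fG GH order_trans)
    \<comment> \<open>Two lower bounds for the boundary modulus of \<open>H n\<close> combine to the
      maximum inside \<open>V n\<close>: \<open>norm (F \<xi>)\<close> through the chain from
      \<open>f\<close> over \<open>G\<close>, and \<open>exp (- n)\<close> through the bound on the
      logarithm.\<close>
    have le: "AE \<xi> in circle_measure. V n \<xi> \<le> ln (norm (radial_limit (H n) \<xi>))"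
      using fH Hln[of n] H0[of n]
    proof eventually_elim
      case (elim \<xi>)
      have "exp (- real n) \<le> exp (ln (norm (radial_limit (H n) \<xi>)))" using elim(2) by simp
      then have "max (norm (F \<xi>)) (exp (- real n)) \<le> norm (radial_limit (H n) \<xi>)"
        using elim by (simp add: F_def)
      then show ?case
        unfolding V_def using elim(3) by (subst ln_le_cancel_iff) (auto simp: less_max_iff_disj)
    qed
    have "AE \<xi> in circle_measure. ln (norm (radial_limit (H n) \<xi>)) - V n \<xi> = 0"
    proof (subst integral_nonneg_eq_0_iff_AE[symmetric])
      show "(LINT \<xi>|circle_measure. ln (norm (radial_limit (H n) \<xi>)) - V n \<xi>) = 0"
        using Bochner_Integration.integral_diff[OF lnint Vint] Hint by simp
    qed (use le lnint Vint in auto)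
    then show ?thesis
      using H0[of n]
    proof eventually_elim
      case (elim \<xi>)
      then have "ln (norm (radial_limit (H n) \<xi>)) = ln (max (norm (F \<xi>)) (exp (- real n)))"
        by (simp add: V_def)
      then show ?case using elim(2) by (subst (asm) ln_inj_iff) (auto simp: less_max_iff_disj)
    qed
  qed
  have fGr: "AE \<xi> in circle_measure. norm (radial_limit f \<xi>) \<le> norm (radial_limit G \<xi>)"
    by (rule AE_radial_limit_rel[OF bf Gb fG])
  have "AE \<xi> in circle_measure. \<forall>n. norm (radial_limit G \<xi>) \<le> norm (radial_limit (H n) \<xi>)"
    unfolding AE_all_countable using AE_radial_limit_rel[OF Gb Hb GH] by blast
  moreover have "AE \<xi> in circle_measure. \<forall>n. norm (radial_limit (H n) \<xi>) = max (norm (F \<xi>)) (exp (- real n))"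
    unfolding AE_all_countable using Heq by blast
  \<comment> \<open>At a given \<open>\<xi>\<close> an \<open>n\<close> beyond
    \<open>- ln (norm (F \<xi>))\<close> makes the floor inactive, and \<open>G\<close> is caught
    between \<open>F\<close> and \<open>H n\<close>. This \<open>n\<close> depends on
    \<open>\<xi>\<close>, so the exceptional sets for all \<open>n\<close> had to be united
    beforehand.\<close>
  ultimately have GF: "AE \<xi> in circle_measure. norm (radial_limit G \<xi>) = norm (F \<xi>)"
    using F0 fGr
  proof eventually_elim
    case (elim \<xi>)
    obtain n :: nat where "- ln (norm (F \<xi>)) < real n" using reals_Archimedean2 by blast
    then have "exp (- real n) \<le> exp (ln (norm (F \<xi>)))" by (subst exp_le_cancel_iff) linarith
    then have "norm (radial_limit (H n) \<xi>) = norm (F \<xi>)" using elim(2,3) by (simp add: max_def)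
    then show ?case using elim(1,4) by (metis F_def order_antisym)
  qed

  define I where "I z = f z / G z" for z
  have Gnz: "G z \<noteq> 0" for z by (simp add: G_def)
  have Ihol: "I holomorphic_on ball 0 1"
    unfolding I_def using hol Ghol Gnz by (intro holomorphic_intros) auto
  have "norm (I z) \<le> 1" if "norm z < 1" for z
    using fG[OF that] Gnz[of z] by (simp add: I_def norm_divide)
  then have Ib: "bounded_analytic I"
    unfolding bounded_analytic_def bounded_iff using Ihol by (intro conjI exI[of _ 1]) auto
  show thesis
  proof
    show "inner_function I"
      unfolding inner_function_def
    proof (intro conjI Ib)
      show "AE \<xi> in circle_measure. \<exists>l. ((\<lambda>r. I (complex_of_real r * \<xi>)) \<longlongrightarrow> l) (at_left 1) \<and> norm l = 1"
        using AE_radial_limit[OF bf] AE_radial_limit[OF Gb] GF F0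
      proof eventually_elim
        case (elim \<xi>)
        then have n0: "radial_limit G \<xi> \<noteq> 0" by auto
        have "((\<lambda>r. I (complex_of_real r * \<xi>)) \<longlongrightarrow> radial_limit f \<xi> / radial_limit G \<xi>) (at_left 1)"
          unfolding I_def by (intro tendsto_divide elim n0)
        moreover have "norm (radial_limit f \<xi> / radial_limit G \<xi>) = 1"
          using elim n0 by (simp add: norm_divide F_def)
        ultimately show ?case by blast
      qed
    qed
    show "integrable circle_measure W" by (rule Wint)
    show "f z = I z * exp (Herglotz W z)" for z by (simp add: I_def G_def)
  qed
qed

text \<open>The numerator, scaled by its bound \<open>B\<close>, is factored; \<open>B\<close> and
  the outer denominator are then absorbed into the outer part. The point \<open>a\<close> rules out
  a vanishing numerator.\<close>

theorem smirnov_inner_factor_exists: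
  assumes \<phi>: "\<phi> \<in> smirnov_class" and a: "norm a < 1" "\<phi> a \<noteq> 0"
  obtains I where "is_inner_factor \<phi> I"
proof -
  obtain f g where f: "bounded_analytic f" and g: "outer_function g"
    and eq: "\<And>z. norm z < 1 \<Longrightarrow> \<phi> z = f z / g z"
    using \<phi> unfolding smirnov_class_def by auto
  obtain B where B: "0 < B" "\<And>z. norm z < 1 \<Longrightarrow> norm (f z) \<le> B"
    using f unfolding bounded_analytic_def bounded_pos by fastforce
  have hol: "(\<lambda>z. f z / complex_of_real B) holomorphic_on ball 0 1"
    using f B(1) unfolding bounded_analytic_def by (intro holomorphic_intros) auto
  have fa: "f a \<noteq> 0" using a eq[OF a(1)] by auto
  obtain I W where I: "inner_function I" and W: "integrable circle_measure W"
    and fI: "\<And>z. norm z < 1 \<Longrightarrow> f z / complex_of_real B = I z * exp (Herglotz W z)"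
    by (rule inner_outer_factorization[OF hol _ a(1)])
       (use B fa in \<open>auto simp: norm_divide divide_le_eq\<close>)
  have "outer_function (\<lambda>z. complex_of_real B * exp (Herglotz W z) / g z)"
    by (rule outer_function_cmult_divide[OF outer_functionI[OF W, of 1] g B(1)]) auto
  moreover have "\<phi> z = I z * (complex_of_real B * exp (Herglotz W z) / g z)" if "norm z < 1" for z
    using fI[OF that] B(1) eq[OF that] by (simp add: field_simps)
  ultimately have "is_inner_factor \<phi> I"
    unfolding is_inner_factor_def using I by auto
  then show thesis by (rule that)
qed

section \<open>Separation of interpolating sequences and the growth obstruction\<close>

lemma pseudohyperbolic_le_1:
  fixes a b :: complex
  assumes "norm a < 1" "norm b < 1"
  shows "norm ((a - b) / (1 - cnj a * b)) \<le> 1"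
  using Moebius_function_norm_lt_1[of a b 0] assms
  by (simp add: Moebius_function_def norm_divide norm_minus_commute)

text \<open>All factors are at most \<open>1\<close>, so partial products decrease, their limit lies
  below each of them, and a partial product containing a given factor lies below that
  factor.\<close>

lemma interpolating_sequence_separated:
  assumes "interpolating_sequence \<Lambda>" "k \<noteq> n"
  shows "separation_constant \<Lambda> \<le> norm ((\<Lambda> k - \<Lambda> n) / (1 - cnj (\<Lambda> k) * \<Lambda> n))"
proof -
  have n1: "norm (\<Lambda> k) < 1" for k
    using assms(1) unfolding interpolating_sequence_def by (auto simp: image_subset_iff)
  define p where "p n k = norm ((\<Lambda> k - \<Lambda> n) / (1 - cnj (\<Lambda> k) * \<Lambda> n))" for n k
  have p: "0 \<le> p n k" "p n k \<le> 1" for n k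
    using pseudohyperbolic_le_1[OF n1 n1] by (auto simp: p_def)
  define P where "P n N = (\<Prod>k\<in>{..<N} - {n}. p n k)" for n N
  have P0: "0 \<le> P n N" for n N unfolding P_def by (intro prod_nonneg) (use p in auto)
  have dec: "decseq (P n)" for n
  proof (rule decseq_SucI)
    fix N
    have "{..<Suc N} - {n} = (if N = n then {..<N} - {n} else insert N ({..<N} - {n}))" by auto
    then show "P n (Suc N) \<le> P n N"
      unfolding P_def using p[of n N] P0[of n N, unfolded P_def] by (auto simp: mult_left_le_one_le)
  qed
  have conv: "convergent (P n)" for n
    using decseq_convergent[OF dec[of n], of 0] P0 unfolding convergent_def by metis
  then have lim: "P n \<longlonglongrightarrow> lim (P n)" for n by (simp add: convergent_LIMSEQ_iff)
  have "separation_constant \<Lambda> = (INF n. lim (P n))"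
    unfolding separation_constant_def P_def[abs_def] p_def ..
  also have "\<dots> \<le> lim (P n)"
  proof (rule cINF_lower)
    show "bdd_below (range (\<lambda>n. lim (P n)))"
      by (rule bdd_belowI[of _ 0]) (use LIMSEQ_le_const[OF lim] P0 in blast)
  qed simp
  \<comment> \<open>\<open>Suc k\<close> is the first length at which the factor with index
    \<open>k\<close> occurs.\<close>
  also have "\<dots> \<le> P n (Suc k)" by (rule decseq_ge[OF dec lim])
  also have "\<dots> = p n k * (\<Prod>j\<in>{..<Suc k} - {n} - {k}. p n j)"
    unfolding P_def by (rule prod.remove) (use assms(2) in auto)
  also have "\<dots> \<le> p n k * 1"
    by (intro mult_left_mono prod_le_1) (use p in auto)
  finally show ?thesis by (simp add: p_def)
qed

text \<open>Infinitely many points in a smaller closed disk would have a convergent subsequence by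
  compactness. The pseudohyperbolic distance of its consecutive terms would tend to
  \<open>0\<close>, although their indices are distinct and separation applies.\<close>

lemma interpolating_sequence_norm_tendsto_1:
  assumes "interpolating_sequence \<Lambda>"
  shows "(\<lambda>n. norm (\<Lambda> n)) \<longlonglongrightarrow> 1"
proof (rule LIMSEQ_I, rule ccontr)
  have pos: "0 < separation_constant \<Lambda>" and n1: "norm (\<Lambda> k) < 1" for k
    using assms unfolding interpolating_sequence_def by (auto simp: image_subset_iff)
  fix e :: real assume "0 < e" and no: "\<not> (\<exists>no. \<forall>n\<ge>no. norm (norm (\<Lambda> n) - 1) < e)"
  have inf: "infinite {n. norm (\<Lambda> n) \<le> 1 - e}"
    unfolding infinite_nat_iff_unbounded_le
  proof
    fix m
    obtain n where "n \<ge> m" "\<not> norm (norm (\<Lambda> n) - 1) < e" using no by blast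
    then show "\<exists>n\<ge>m. n \<in> {n. norm (\<Lambda> n) \<le> 1 - e}" using n1[of n] by auto
  qed
  define t where "t = enumerate {n. norm (\<Lambda> n) \<le> 1 - e}"
  have t: "strict_mono t" and tn: "norm (\<Lambda> (t i)) \<le> 1 - e" for i
    using strict_mono_enumerate[OF inf] enumerate_in_set[OF inf] by (auto simp: t_def)
  have "compact (cball (0::complex) (1 - e))" by simp
  then obtain l s where l: "l \<in> cball 0 (1 - e)" and s: "strict_mono s" "((\<Lambda> \<circ> t) \<circ> s) \<longlonglongrightarrow> l"
    using tn unfolding compact_def by (metis comp_apply mem_cball_0)
  define u where "u i = \<Lambda> (t (s i))" for i
  have u: "u \<longlonglongrightarrow> l" using s(2) by (simp add: u_def[abs_def] o_def)
  have lt: "norm l < 1" using l \<open>0 < e\<close> by simp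
  have nz: "1 - cnj l * l \<noteq> 0"
  proof
    assume "1 - cnj l * l = 0"
    then have "norm (cnj l * l) = 1" by (metis eq_iff_diff_eq_0 norm_one)
    then have "norm l * norm l = 1" by (simp add: norm_mult)
    then show False using lt mult_strict_mono[of "norm l" 1 "norm l" 1] by simp
  qed
  have "(\<lambda>i. norm ((u (Suc i) - u i) / (1 - cnj (u (Suc i)) * u i))) \<longlonglongrightarrow> norm ((l - l) / (1 - cnj l * l))"
    by (intro tendsto_intros u LIMSEQ_Suc nz)
  moreover have "separation_constant \<Lambda> \<le> norm ((u (Suc i) - u i) / (1 - cnj (u (Suc i)) * u i))" for i
    unfolding u_def
  proof (rule interpolating_sequence_separated[OF assms])
    show "t (s (Suc i)) \<noteq> t (s i)"
      using strict_monoD[OF t strict_monoD[OF s(1), of i "Suc i"]] by simp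
  qed
  ultimately have "separation_constant \<Lambda> \<le> norm ((l - l) / (1 - cnj l * l))"
    by (intro LIMSEQ_le_const) auto
  then show False using pos by simp
qed

lemma outer_function_growth:
  assumes "outer_function G" "\<And>n. norm (z n) < 1" "(\<lambda>n. norm (z n)) \<longlonglongrightarrow> 1"
  shows "(\<lambda>n. (1 - norm (z n)) * ln (norm (G (z n)))) \<longlonglongrightarrow> 0"
proof -
  obtain \<gamma> W where G: "norm \<gamma> = 1" "integrable circle_measure W"
    "\<And>z. norm z < 1 \<Longrightarrow> G z = \<gamma> * exp (Herglotz W z)"
    using outer_functionE[OF assms(1)] by metis
  have "ln (norm (G (z n))) = (LINT \<xi>|circle_measure. Poisson (z n) \<xi> * W \<xi>)" for n
    using norm_exp_Herglotz[OF G(2) assms(2)[of n]] by (simp only: G(3)[OF assms(2)] norm_mult G(1) mult_1_left ln_exp)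
  then show ?thesis using Poisson_integral_growth[OF G(2) assms(2,3)] by simp
qed

theorem theorem4p1:
  fixes \<Lambda> w :: "nat \<Rightarrow> complex" and \<phi> :: "complex \<Rightarrow> complex"
  assumes "interpolating_sequence \<Lambda>"
    and "\<And>n. w n \<noteq> 0"
    and "\<not> (\<lambda>n. (1 - norm (\<Lambda> n)) * ln (norm (w n))) \<longlonglongrightarrow> 0"
    and "\<phi> \<in> smirnov_class"
    and "\<And>n. \<phi> (\<Lambda> n) = w n"
  shows "\<exists>I. is_inner_factor \<phi> I \<and> \<not> I constant_on unit_disk"
proof -
  have n1: "norm (\<Lambda> n) < 1" for n
    using assms(1) unfolding interpolating_sequence_def by (auto simp: image_subset_iff)
  have l1: "(\<lambda>n. norm (\<Lambda> n)) \<longlonglongrightarrow> 1" by (rule interpolating_sequence_norm_tendsto_1[OF assms(1)])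
  \<comment> \<open>The value \<open>w 0 \<noteq> 0\<close> at \<open>\<Lambda> 0\<close> shows that
    \<open>\<phi>\<close> is not identically zero, as the factorization requires.\<close>
  obtain I where I: "is_inner_factor \<phi> I"
    using smirnov_inner_factor_exists[OF assms(4) n1[of 0]] assms(2,5) by metis
  then obtain G where G: "outer_function G" "\<And>z. norm z < 1 \<Longrightarrow> \<phi> z = I z * G z"
    unfolding is_inner_factor_def by auto
  have "\<not> I constant_on unit_disk"
  proof
    assume "I constant_on unit_disk"
    then obtain c where c: "\<And>z. norm z < 1 \<Longrightarrow> I z = c" unfolding constant_on_def by auto
    have w: "w n = c * G (\<Lambda> n)" for n using assms(5)[of n] G(2)[OF n1] c[OF n1] by simp
    \<comment> \<open>Both factors are nonzero because \<open>w n\<close> is, so the logarithm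
      splits. The summand \<open>ln (norm c)\<close> is a fixed number, which the weight
      \<open>1 - norm (\<Lambda> n)\<close> sends to \<open>0\<close>.\<close>
    have ln: "ln (norm (w n)) = ln (norm c) + ln (norm (G (\<Lambda> n)))" for n
      using assms(2)[of n] unfolding w by (simp add: norm_mult ln_mult)
    have "(\<lambda>n. (1 - norm (\<Lambda> n)) * ln (norm c) + (1 - norm (\<Lambda> n)) * ln (norm (G (\<Lambda> n)))) \<longlonglongrightarrow> (1 - 1) * ln (norm c) + 0"
      by (intro tendsto_intros l1 outer_function_growth[OF G(1) n1])
    then show False using assms(3) by (simp add: ln distrib_left)
  qed
  with I show ?thesis by blast
qed

end
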